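(* Let $(T,m)$ be a flow tree with flow Laplacian $\mathcal{L}$, and let $p\in[1,\infty]$. The spectrum of $\mathcal{L}$ on $L^p(m)$ is the interval $[0,2]$.
   Context: A tree $T$ is an infinite connected graph without cycles, locally finite, identified with its set of vertices. A tree with root at infinity is such a tree with a fixed boundary point (end) $\omega_*\in\partial T$. For $x\in T$, the predecessor $\mathfrak{p}(x)$ is the neighbour of $x$ lying on the semi-infinite geodesic from $x$ to $\omega_*$; the remaining neighbours form the set $\mathfrak{s}(x)$ of successors. A flow measure on $T$ is a function $m:T\to(0,\infty)$ with $m(x)=\sum_{y\in\mathfrak{s}(x)}m(y)$ for all $x\in T$, identified with the measure of density $m$ with respect to counting measure; $(T,m)$ is then a flow tree. The flow Laplacian is $\mathcal{L}=\frac12\nabla^*\nabla$ with $\nabla f(x)=f(x)-f(\mathfrak{p}(x))$, i.e. $$\mathcal{L}f(x)=f(x)-\frac12f(\mathfrak{p}(x))-\frac1{2m(x)}\sum_{y\in\mathfrak{s}(x)}f(y)\,m(y),$$ which is bounded on $L^p(m)$ for every $p\in[1,\infty]$. *)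

theory Defs
  imports "HOL-Probability.Essential_Supremum"
begin

section \<open>Trees with a root at infinity\<close>

text \<open>
  A simple graph is given by a symmetric irreflexive adjacency relation; its vertex set is the
  whole type \<^typ>\<open>'a\<close>.
\<close>

text \<open>The vertices of a cycle are listed once; there are at least three of them, so that going back
  and forth along an edge is not a cycle.\<close>
definition is_cycle :: "('a \<Rightarrow> 'a \<Rightarrow> bool) \<Rightarrow> 'a list \<Rightarrow> bool" where
  "is_cycle adj xs \<longleftrightarrow>
     3 \<le> length xs \<and> distinct xs \<and> successively adj xs \<and> adj (last xs) (hd xs)"

locale infinite_tree =
  fixes adj :: "'a \<Rightarrow> 'a \<Rightarrow> bool"
  assumes infinite_vertices: "infinite (UNIV :: 'a set)"
    and adj_sym: "symp adj"
    and adj_irrefl: "irreflp adj"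
    and connected: "adj\<^sup>*\<^sup>* x y"
    and acyclic: "\<not> is_cycle adj xs"
    and locally_finite: "finite {y. adj x y}"

text \<open>The number of edges of a shortest path (meaningful in connected graphs only).\<close>
definition graph_dist :: "('a \<Rightarrow> 'a \<Rightarrow> bool) \<Rightarrow> 'a \<Rightarrow> 'a \<Rightarrow> nat" where
  "graph_dist adj x y = (LEAST n. (adj ^^ n) x y)"

definition geodesic_ray :: "('a \<Rightarrow> 'a \<Rightarrow> bool) \<Rightarrow> (nat \<Rightarrow> 'a) \<Rightarrow> bool" where
  "geodesic_ray adj \<gamma> \<longleftrightarrow> (\<forall>i j. i \<le> j \<longrightarrow> graph_dist adj (\<gamma> i) (\<gamma> j) = j - i)"

text \<open>Two geodesic rays have the same end if, up to a shift, they eventually coincide.\<close>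
definition same_end :: "('a \<Rightarrow> 'a \<Rightarrow> bool) \<Rightarrow> ((nat \<Rightarrow> 'a) \<times> (nat \<Rightarrow> 'a)) set" where
  "same_end adj = {(\<gamma>, \<delta>). geodesic_ray adj \<gamma> \<and> geodesic_ray adj \<delta> \<and>
     (\<exists>k l. \<forall>n. \<gamma> (n + k) = \<delta> (n + l))}"

definition tree_boundary :: "('a \<Rightarrow> 'a \<Rightarrow> bool) \<Rightarrow> (nat \<Rightarrow> 'a) set set" where
  "tree_boundary adj = {\<gamma>. geodesic_ray adj \<gamma>} // same_end adj"

text \<open>An end \<open>\<omega>\<close> is an equivalence class of rays, so \<open>\<gamma> \<in> \<omega>\<close> with \<open>\<gamma> 0 = x\<close> says that \<open>\<gamma>\<close> is
  the geodesic from \<open>x\<close> to \<open>\<omega>\<close>.\<close>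
definition predecessor :: "('a \<Rightarrow> 'a \<Rightarrow> bool) \<Rightarrow> (nat \<Rightarrow> 'a) set \<Rightarrow> 'a \<Rightarrow> 'a" where
  "predecessor adj \<omega> x = (THE y. adj x y \<and> (\<exists>\<gamma>\<in>\<omega>. \<gamma> 0 = x \<and> y \<in> range \<gamma>))"

definition successors :: "('a \<Rightarrow> 'a \<Rightarrow> bool) \<Rightarrow> (nat \<Rightarrow> 'a) set \<Rightarrow> 'a \<Rightarrow> 'a set" where
  "successors adj \<omega> x = {y. adj x y} - {predecessor adj \<omega> x}"

locale rooted_tree = infinite_tree +
  fixes \<omega> :: "(nat \<Rightarrow> 'a) set"
  assumes end_at_infinity: "\<omega> \<in> tree_boundary adj"

locale flow_tree = rooted_tree +
  fixes m :: "'a \<Rightarrow> real"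
  assumes flow_pos: "0 < m x"
    and flow_eq: "m x = (\<Sum>y\<in>successors adj \<omega> x. m y)"

definition flow_measure :: "('a \<Rightarrow> real) \<Rightarrow> 'a measure" where
  "flow_measure m = density (count_space UNIV) (\<lambda>x. ennreal (m x))"

definition flow_laplacian ::
    "('a \<Rightarrow> 'a \<Rightarrow> bool) \<Rightarrow> (nat \<Rightarrow> 'a) set \<Rightarrow> ('a \<Rightarrow> real) \<Rightarrow> ('a \<Rightarrow> complex) \<Rightarrow> 'a \<Rightarrow> complex" where
  "flow_laplacian adj \<omega> m f x =
     f x - 1 / 2 * f (predecessor adj \<omega> x)
       - 1 / (2 * of_real (m x)) * (\<Sum>y\<in>successors adj \<omega> x. f y * of_real (m y))"


section \<open>Lebesgue spaces and the spectrum of an operator\<close>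

text \<open>
  Elements of \<open>Lp_space M p\<close> are functions, not classes of functions modulo null sets. For a flow
  measure the only null set is the empty one, so that there is no difference.
\<close>

definition Lp_space :: "'a measure \<Rightarrow> ennreal \<Rightarrow> ('a \<Rightarrow> complex) set" where
  "Lp_space M p = {f \<in> borel_measurable M.
     if p = \<infinity> then esssup M (\<lambda>x. ennreal (norm (f x))) < \<infinity>
     else integrable M (\<lambda>x. norm (f x) powr enn2real p)}"

definition Lp_norm :: "'a measure \<Rightarrow> ennreal \<Rightarrow> ('a \<Rightarrow> complex) \<Rightarrow> real" where
  "Lp_norm M p f =
     (if p = \<infinity> then enn2real (esssup M (\<lambda>x. ennreal (norm (f x))))
      else (\<integral>x. norm (f x) powr enn2real p \<partial>M) powr (1 / enn2real p))"

text \<open>In the following, \<open>V\<close> is a space of complex functions, normed by \<open>N\<close>. Operators are total on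
  \<^typ>\<open>'a \<Rightarrow> complex\<close>, but only their values on \<open>V\<close> are relevant.\<close>

definition bounded_operator_on ::
    "('a \<Rightarrow> complex) set \<Rightarrow> (('a \<Rightarrow> complex) \<Rightarrow> real) \<Rightarrow>
     (('a \<Rightarrow> complex) \<Rightarrow> ('a \<Rightarrow> complex)) \<Rightarrow> bool" where
  "bounded_operator_on V N R \<longleftrightarrow>
     (\<forall>f\<in>V. R f \<in> V) \<and>
     (\<forall>f\<in>V. \<forall>g\<in>V. \<forall>a b. R (\<lambda>x. a * f x + b * g x) = (\<lambda>x. a * R f x + b * R g x)) \<and>
     (\<exists>C. \<forall>f\<in>V. N (R f) \<le> C * N f)"

definition resolvent_set_on ::
    "('a \<Rightarrow> complex) set \<Rightarrow> (('a \<Rightarrow> complex) \<Rightarrow> real) \<Rightarrow>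
     (('a \<Rightarrow> complex) \<Rightarrow> ('a \<Rightarrow> complex)) \<Rightarrow> complex set" where
  "resolvent_set_on V N A = {z. \<exists>R. bounded_operator_on V N R \<and>
     (\<forall>f\<in>V. R (\<lambda>x. z * f x - A f x) = f \<and> (\<lambda>x. z * R f x - A (R f) x) = f)}"

definition spectrum_on ::
    "('a \<Rightarrow> complex) set \<Rightarrow> (('a \<Rightarrow> complex) \<Rightarrow> real) \<Rightarrow>
     (('a \<Rightarrow> complex) \<Rightarrow> ('a \<Rightarrow> complex)) \<Rightarrow> complex set" where
  "spectrum_on V N A = - resolvent_set_on V N A"

end

theory Submission
  imports Defs
begin

text \<open>
  Write \<open>S f = f \<circ> p\<close> with \<open>p\<close> the predecessor map, and let \<open>T\<close> average over successors with respect
  to \<open>m\<close>. Both operators contract every Lebesgue norm by Jensen's inequality, \<open>T S = 1\<close>, and the flow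
  Laplacian is \<open>1 - (S + T) / 2\<close>.

  If \<open>z\<close> lies outside \<open>[0, 2]\<close>, then \<open>2 (1 - z) = q + 1 / q\<close> for some \<open>q\<close> in the punctured unit disc,
  and \<open>T S = 1\<close> gives \<open>2 (1 - z) - S - T = (1 - q T) (1 - q S) / q\<close>, whose two factors are inverted
  by Neumann series.

  If \<open>z \<in> [0, 2]\<close>, then \<open>q\<close> has modulus one. The indicators of the generations of descendants
  of a vertex are disjointly supported and moved by \<open>S\<close> and \<open>T\<close> like the unit vectors of a
  unilateral shift, so \<open>q ^ n\<close> times a wide tent in the generation \<open>n\<close> is an approximate eigenfunction.

  That the successors of \<open>x\<close> are exactly the vertices with predecessor \<open>x\<close>, and that the
  predecessor map has no periodic points, comes from the Busemann function of the end, which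
  decreases by one along the edge to the predecessor and increases by one along all others.
\<close>

section \<open>Trees and Busemann functions\<close>

text \<open>The sequence is frozen from an index that minimises \<open>nat (u n - L)\<close>. For
  integer-valued distances, limits thus become eventual equalities.\<close>

lemma decreasing_int_eventually_constant:
  fixes u :: "nat \<Rightarrow> int"
  assumes "\<And>n. u (Suc n) \<le> u n" and "\<And>n. L \<le> u n"
  shows "\<exists>c. \<forall>\<^sub>F n in sequentially. u n = c"
proof -
  obtain N where N: "\<And>n. nat (u N - L) \<le> nat (u n - L)"
    using ex_has_least_nat[of "\<lambda>_. True" 0 "\<lambda>n. nat (u n - L)"]
    by auto
  have "decseq u"
    using assms(1) by (rule decseq_SucI)
  then have "u n = u N" if "n \<ge> N" for n
    using decseqD[of u N n] that N[of n] assms(2)[of n] assms(2)[of N] by linarith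
  then show ?thesis
    unfolding eventually_sequentially by blast
qed

section \<open>Distances in a tree\<close>

context infinite_tree
begin

abbreviation d :: "'a \<Rightarrow> 'a \<Rightarrow> nat" where
  "d \<equiv> graph_dist adj"

lemma adj_commute: "adj x y \<longleftrightarrow> adj y x"
  using adj_sym by (auto dest: sympD)

lemma adj_neq: "adj x y \<Longrightarrow> x \<noteq> y"
  using adj_irrefl by (auto dest: irreflpD)

lemma relpowp_graph_dist: "(adj ^^ d x y) x y"
  unfolding graph_dist_def
  using rtranclp_imp_relpowp[OF connected[of x y]] by (metis LeastI)

lemma graph_dist_le: "(adj ^^ n) x y \<Longrightarrow> d x y \<le> n"
  unfolding graph_dist_def by (rule Least_le)

lemma graph_dist_refl [simp]: "d x x = 0"
  using graph_dist_le[of 0 x x] by simp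

lemma graph_dist_eq_0D: "d x y = 0 \<Longrightarrow> x = y"
  using relpowp_graph_dist[of x y] by simp

lemma graph_dist_triangle: "d x z \<le> d x y + d y z"
  by (intro graph_dist_le relpowp_trans[OF relpowp_graph_dist relpowp_graph_dist])

lemma graph_dist_adj: "adj x y \<Longrightarrow> d x y = 1"
  using graph_dist_le[of 1 x y] graph_dist_eq_0D[of x y] adj_neq[of x y]
  by (cases "d x y") auto

lemma adj_if_graph_dist_1: "d x y = 1 \<Longrightarrow> adj x y"
  using relpowp_graph_dist[of x y] relpowp_1[of adj] by metis

lemma graph_dist_adj_le: "adj x y \<Longrightarrow> d x z \<le> Suc (d y z)"
  using graph_dist_triangle[of x z y] graph_dist_adj[of x y] by simp

lemma closer_neighbour:
  assumes "d x v = Suc k"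
  obtains y where "adj x y" "d y v = k"
proof -
  obtain y where y: "adj x y" "(adj ^^ k) y v"
    using relpowp_graph_dist[of x v] assms relpowp_Suc_D2[of k adj x v] by auto
  then have "d y v \<le> k" "d x v \<le> Suc (d y v)"
    using graph_dist_le graph_dist_adj_le by auto
  with y assms that show ?thesis
    by (metis Suc_le_mono le_antisym)
qed

text \<open>Prolonging both ends of the path towards \<open>v\<close> eventually closes it to a cycle.\<close>

lemma no_path_outside_ball:
  assumes "distinct xs" "successively adj xs" "2 \<le> length xs"
    and "d (hd xs) v = k" "d (last xs) v = k" "\<forall>x\<in>set xs. k \<le> d x v"
  shows False
  using assms
proof (induction k arbitrary: xs)
  case 0
  then have "hd xs = last xs"
    by (metis graph_dist_eq_0D)
  with 0 show False
    by (cases xs) (auto split: if_splits)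
next
  case (Suc k)
  have ne: "xs \<noteq> []"
    using Suc.prems by auto
  obtain y where y: "adj (hd xs) y" "d y v = k"
    using Suc.prems closer_neighbour by metis
  obtain z where z: "adj (last xs) z" "d z v = k"
    using Suc.prems closer_neighbour by metis
  have new: "y \<notin> set xs" "z \<notin> set xs"
    using y z Suc.prems by fastforce+
  have path: "successively adj (y # xs)"
    using Suc.prems y ne by (simp add: successively_Cons adj_commute)
  show False
  proof (cases "y = z")
    case True
    then have "is_cycle adj (y # xs)"
      unfolding is_cycle_def using Suc.prems y z ne path new by auto
    then show False
      using acyclic by blast
  next
    case False
    have "successively adj ((y # xs) @ [z])"
      using path ne z by (subst successively_append_iff) auto
    then show False
      using Suc.IH[of "(y # xs) @ [z]"] Suc.prems False new y z by (auto intro: Suc_leD)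
  qed
qed

text \<open>An edge between vertices equally far from \<open>v\<close> would be a path excluded by
  \<open>no_path_outside_ball\<close>; in other words, a tree is bipartite.\<close>

lemma graph_dist_adj_neq:
  assumes "adj x y"
  shows "d x v \<noteq> d y v"
  using no_path_outside_ball[of "[x, y]" v "d x v"] assms adj_neq by auto

text \<open>Two distinct such neighbours would be joined by the path \<open>[y, x, z]\<close>, which
  never gets closer to \<open>v\<close> than its ends.\<close>

lemma closer_neighbour_unique:
  assumes "adj x y" "adj x z" "Suc (d y v) = d x v" "Suc (d z v) = d x v"
  shows "y = z"
proof (rule ccontr)
  assume "y \<noteq> z"
  then show False
    using no_path_outside_ball[of "[y, x, z]" v "d y v"] assms adj_neq[of x] adj_commute by auto
qed

section \<open>The Busemann function of a geodesic ray\<close>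

definition busemann :: "(nat \<Rightarrow> 'a) \<Rightarrow> 'a \<Rightarrow> int" where
  "busemann \<gamma> x = (THE c. \<forall>\<^sub>F n in sequentially. int (d x (\<gamma> n)) - int n = c)"

context
  fixes \<gamma> :: "nat \<Rightarrow> 'a"
  assumes ray: "geodesic_ray adj \<gamma>"
begin

abbreviation b :: "'a \<Rightarrow> int" where
  "b \<equiv> busemann \<gamma>"

lemma ray_dist: "i \<le> j \<Longrightarrow> d (\<gamma> i) (\<gamma> j) = j - i"
  using ray unfolding geodesic_ray_def by blast

lemma ray_adj: "adj (\<gamma> n) (\<gamma> (Suc n))"
  using ray_dist[of n "Suc n"] by (intro adj_if_graph_dist_1) simp

text \<open>By the triangle inequality, distance minus index is nonincreasing along the ray and
  bounded below. Hence the \<open>THE\<close> in \<open>busemann\<close> denotes a genuine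
  value.\<close>

lemma busemann_eventually: "\<forall>\<^sub>F n in sequentially. int (d x (\<gamma> n)) = int n + b x"
proof -
  let ?u = "\<lambda>n. int (d x (\<gamma> n)) - int n"
  have "\<exists>c. \<forall>\<^sub>F n in sequentially. ?u n = c"
  proof (rule decreasing_int_eventually_constant)
    show "?u (Suc n) \<le> ?u n" for n
      using graph_dist_triangle[of x "\<gamma> (Suc n)" "\<gamma> n"] ray_dist[of n "Suc n"] by simp
    show "- int (d (\<gamma> 0) x) \<le> ?u n" for n
      using graph_dist_triangle[of "\<gamma> 0" "\<gamma> n" x] ray_dist[of 0 n] by simp
  qed
  then obtain c where c: "\<forall>\<^sub>F n in sequentially. ?u n = c"
    by blast
  have "c' = c" if "\<forall>\<^sub>F n in sequentially. ?u n = c'" for c'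
  proof -
    \<comment> \<open>The claim does not mention \<open>n\<close>, and the filter is nontrivial, so
      eventual truth is truth. Several lemmas below exploit far points of the ray in this
      way.\<close>
    have "\<forall>\<^sub>F n::nat in sequentially. c' = c"
      using that c by eventually_elim simp
    then show ?thesis
      by simp
  qed
  with c have "b x = c"
    unfolding busemann_def by (intro the_equality)
  with c show ?thesis
    by (auto elim: eventually_mono)
qed

lemma busemann_eq_if_eventually:
  assumes "\<forall>\<^sub>F n in sequentially. int (d x (\<gamma> n)) = int n + c"
  shows "b x = c"
proof -
  have "\<forall>\<^sub>F n::nat in sequentially. b x = c"
    using assms busemann_eventually[of x] by eventually_elim simp
  then show ?thesis
    by simp
qed

lemma busemann_ray: "b (\<gamma> k) = - int k"
  by (rule busemann_eq_if_eventually)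
    (auto simp: eventually_sequentially ray_dist of_nat_diff intro!: exI[of _ k])

text \<open>Seen from a far point of the ray, the distances of two neighbours differ by at most one,
  and by \<open>graph_dist_adj_neq\<close> they do differ.\<close>

lemma busemann_adj:
  assumes "adj x y"
  shows "b y = b x - 1 \<or> b y = b x + 1"
proof -
  have "\<forall>\<^sub>F n::nat in sequentially. b y = b x - 1 \<or> b y = b x + 1"
    using busemann_eventually[of x] busemann_eventually[of y]
  proof eventually_elim
    case (elim n)
    show ?case
      using elim graph_dist_adj_le[of x y "\<gamma> n"] graph_dist_adj_le[of y x "\<gamma> n"]
        graph_dist_adj_neq[of x y "\<gamma> n"] assms adj_commute[of x y] by auto
  qed
  then show ?thesis
    by simp
qed

lemma busemann_neighbour_unique:
  assumes "adj x y" "adj x z" "b y = b x - 1" "b z = b x - 1"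
  shows "y = z"
proof -
  have "\<forall>\<^sub>F n::nat in sequentially. y = z"
    using busemann_eventually[of x] busemann_eventually[of y] busemann_eventually[of z]
  proof eventually_elim
    case (elim n)
    then show ?case
      using assms by (intro closer_neighbour_unique[of x y z "\<gamma> n"]) auto
  qed
  then show ?thesis
    by simp
qed

lemma busemann_dist_le: "b x \<le> b y + int (d x y)"
proof -
  have "\<forall>\<^sub>F n::nat in sequentially. b x \<le> b y + int (d x y)"
    using busemann_eventually[of x] busemann_eventually[of y]
  proof eventually_elim
    case (elim n)
    then show ?case
      using graph_dist_triangle[of x "\<gamma> n" y] by linarith
  qed
  then show ?thesis
    by simp
qed

lemma busemann_neighbour_exists:
  obtains y where "adj x y" "b y = b x - 1"
proof -
  \<comment> \<open>Positivity of the distance guarantees a first edge from \<open>x\<close> towards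
    \<open>\<gamma> n\<close>.\<close>
  have "\<forall>\<^sub>F n in sequentially. int (d x (\<gamma> n)) = int n + b x \<and> int n + b x > 0"
    by (intro eventually_conj busemann_eventually eventually_sequentiallyI[of "nat (1 - b x)"]) auto
  then obtain n where n: "int (d x (\<gamma> n)) = int n + b x" "int n + b x > 0"
    using eventually_happens by fastforce
  then obtain k where "d x (\<gamma> n) = Suc k"
    by (cases "d x (\<gamma> n)") auto
  then obtain y where y: "adj x y" "d y (\<gamma> n) = k"
    by (rule closer_neighbour)
  \<comment> \<open>The Busemann function is 1-Lipschitz and equals \<open>- n\<close> at
    \<open>\<gamma> n\<close>, so \<open>b y \<le> k - n\<close>, while
    \<open>b x = k + 1 - n\<close>.\<close>
  have "b y < b x"
    using busemann_dist_le[of y "\<gamma> n"] busemann_ray[of n] n y \<open>d x (\<gamma> n) = Suc k\<close> by simp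
  with y that show ?thesis
    using busemann_adj[of x y] by force
qed

section \<open>The parent map and its agreement with the predecessor\<close>

definition parent :: "'a \<Rightarrow> 'a" where
  "parent x = (SOME y. adj x y \<and> b y = b x - 1)"

lemma parent: "adj x (parent x)" "b (parent x) = b x - 1"
  using someI_ex[of "\<lambda>y. adj x y \<and> b y = b x - 1"] busemann_neighbour_exists[of x]
  unfolding parent_def by blast+

lemma parent_eqI: "adj x y \<Longrightarrow> b y = b x - 1 \<Longrightarrow> parent x = y"
  using parent busemann_neighbour_unique by blast

lemma busemann_funpow_parent: "b ((parent ^^ n) x) = b x - int n"
  by (induction n) (auto simp: parent)

lemma relpowp_funpow_parent: "(adj ^^ n) x ((parent ^^ n) x)"
  by (induction n) (auto intro: parent)

text \<open>Each step to the parent lowers the Busemann function by one, and this function is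
  1-Lipschitz, so no shortcut exists.\<close>

lemma geodesic_ray_funpow_parent: "geodesic_ray adj (\<lambda>n. (parent ^^ n) x)"
  unfolding geodesic_ray_def
proof (intro allI impI)
  fix i j :: nat
  assume "i \<le> j"
  then have eq: "(parent ^^ j) x = (parent ^^ (j - i)) ((parent ^^ i) x)"
    by (metis comp_apply funpow_add le_add_diff_inverse2)
  have "d ((parent ^^ i) x) ((parent ^^ j) x) \<le> j - i"
    unfolding eq by (rule graph_dist_le[OF relpowp_funpow_parent])
  with \<open>i \<le> j\<close> show "d ((parent ^^ i) x) ((parent ^^ j) x) = j - i"
    using busemann_dist_le[of "(parent ^^ i) x" "(parent ^^ j) x"]
    by (simp add: busemann_funpow_parent)
qed

lemma funpow_parent_ray: "(parent ^^ n) (\<gamma> k) = \<gamma> (n + k)"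
proof (induction n)
  case (Suc n)
  then show ?case
    using parent_eqI[OF ray_adj[of "n + k"]] by (simp add: busemann_ray)
qed auto

text \<open>The hypothesis says that the distance to \<open>\<gamma> n\<close> equals the total drop
  of the Busemann function. Every edge of a shortest path must then lower it by one, which makes the
  edge a parent edge.\<close>

lemma funpow_parent_reaches:
  assumes "int (d x (\<gamma> n)) = b x + int n"
  shows "(parent ^^ d x (\<gamma> n)) x = \<gamma> n"
  using assms
proof (induction "d x (\<gamma> n)" arbitrary: x)
  case 0
  then show ?case
    using graph_dist_eq_0D by force
next
  case (Suc k)
  from Suc.hyps(2) obtain y where y: "adj x y" "d y (\<gamma> n) = k"
    using closer_neighbour by metis
  have "b y = b x - 1"
    using busemann_adj[OF y(1)] busemann_dist_le[of y "\<gamma> n"] Suc.prems Suc.hyps(2) y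
    by (auto simp: busemann_ray)
  then have "parent x = y" "(parent ^^ k) y = \<gamma> n"
    using parent_eqI y Suc.hyps(1)[of y] Suc.hyps(2) Suc.prems by auto
  then show ?case
    using Suc.hyps(2)[symmetric] by (simp add: funpow_swap1)
qed

lemma same_end_funpow_parent: "(\<gamma>, \<lambda>n. (parent ^^ n) x) \<in> same_end adj"
proof -
  obtain k where k: "int (d x (\<gamma> k)) = int k + b x"
    using eventually_happens[OF busemann_eventually] by fastforce
  then have "(parent ^^ d x (\<gamma> k)) x = \<gamma> k"
    by (intro funpow_parent_reaches) simp
  then have "\<gamma> (n + k) = (parent ^^ (n + d x (\<gamma> k))) x" for n
    by (simp add: funpow_add funpow_parent_ray)
  then show ?thesis
    unfolding same_end_def using ray geodesic_ray_funpow_parent by blast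
qed

text \<open>This is the uniqueness behind the \<open>THE\<close> in \<open>predecessor\<close>: far
  out, \<open>\<delta>\<close> is a shift of \<open>\<gamma>\<close>, which forces the Busemann
  function to drop on the first edge of \<open>\<delta>\<close>.\<close>

lemma parent_eq_if_same_end:
  assumes "(\<gamma>, \<delta>) \<in> same_end adj" "adj (\<delta> 0) y" "y \<in> range \<delta>"
  shows "parent (\<delta> 0) = y"
proof -
  obtain k l where kl: "\<And>n. \<gamma> (n + k) = \<delta> (n + l)" and \<delta>: "geodesic_ray adj \<delta>"
    using assms(1) unfolding same_end_def by blast
  obtain i where i: "y = \<delta> i"
    using assms(3) by blast
  have "d (\<delta> 0) (\<delta> i) = i"
    using \<delta> unfolding geodesic_ray_def by simp
  then have "y = \<delta> 1"
    using i assms(2) graph_dist_adj[of "\<delta> 0" y] by simp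
  \<comment> \<open>Far out, \<open>\<gamma> n\<close> is \<open>\<delta> (n - k + l)\<close>. With
    \<open>j \<le> 1\<close>, the bound \<open>Suc k \<le> n\<close> keeps the truncated
    subtractions exact.\<close>
  have *: "b (\<delta> j) = int l - int j - int k" if "j \<le> 1" for j
  proof (rule busemann_eq_if_eventually, rule eventually_sequentiallyI[of "Suc k"])
    fix n assume n: "Suc k \<le> n"
    have "d (\<delta> j) (\<gamma> n) = (n - k + l) - j"
      using kl[of "n - k"] \<delta> that n unfolding geodesic_ray_def by auto
    then show "int (d (\<delta> j) (\<gamma> n)) = int n + (int l - int j - int k)"
      using n that by simp
  qed
  show ?thesis
    using *[of 0] *[of 1] assms(2) unfolding \<open>y = \<delta> 1\<close> by (intro parent_eqI) auto
qed

lemma funpow_parent_aperiodic: "(parent ^^ n) x = x \<Longrightarrow> n = 0"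
  using busemann_funpow_parent[of n x] by simp

text \<open>Along an edge, the end with the smaller Busemann value is the parent of the other. Hence
  successor sets are fibres of the parent map.\<close>

lemma adj_not_parent:
  assumes "adj x y"
  shows "y \<noteq> parent x \<longleftrightarrow> parent y = x"
proof
  assume "y \<noteq> parent x"
  then have "b x = b y - 1"
    using busemann_adj[OF assms] parent_eqI[OF assms] by fastforce
  then show "parent y = x"
    using assms adj_commute by (intro parent_eqI) blast+
next
  assume "parent y = x"
  then show "y \<noteq> parent x"
    using parent(2)[of y] parent(2)[of x] by auto
qed

end

end

context rooted_tree
begin

text \<open>The spectral part takes just these facts from the geometry of the end; no ray or
  Busemann function appears after this point.\<close>

lemma predecessor_structure:
  obtains "\<And>x. adj x (predecessor adj \<omega> x)"
    and "\<And>x. successors adj \<omega> x = {y. predecessor adj \<omega> y = x}"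
    and "\<And>n x. (predecessor adj \<omega> ^^ n) x = x \<Longrightarrow> n = 0"
proof -
  obtain \<gamma> where ray: "geodesic_ray adj \<gamma>" and \<omega>: "\<omega> = same_end adj `` {\<gamma>}"
    using end_at_infinity unfolding tree_boundary_def quotient_def by blast
  note parent = parent[OF ray]
  have pred: "predecessor adj \<omega> x = parent \<gamma> x" for x
    unfolding predecessor_def
  proof (rule the_equality)
    have "parent \<gamma> x = (parent \<gamma> ^^ 1) x"
      by simp
    then have "parent \<gamma> x \<in> range (\<lambda>n. (parent \<gamma> ^^ n) x)"
      by (rule range_eqI)
    moreover have "(\<lambda>n. (parent \<gamma> ^^ n) x) \<in> \<omega>"
      using same_end_funpow_parent[OF ray] \<omega> by blast
    ultimately show "adj x (parent \<gamma> x) \<and> (\<exists>\<delta>\<in>\<omega>. \<delta> 0 = x \<and> parent \<gamma> x \<in> range \<delta>)"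
      using parent(1) by (intro conjI bexI[of _ "\<lambda>n. (parent \<gamma> ^^ n) x"]) auto
    show "y = parent \<gamma> x" if "adj x y \<and> (\<exists>\<delta>\<in>\<omega>. \<delta> 0 = x \<and> y \<in> range \<delta>)" for y
    proof -
      from that obtain \<delta> where "\<delta> \<in> \<omega>" "\<delta> 0 = x" "y \<in> range \<delta>" "adj x y"
        by blast
      then show ?thesis
        using parent_eq_if_same_end[OF ray, of \<delta> y] \<omega> by simp
    qed
  qed
  have pred': "predecessor adj \<omega> = parent \<gamma>"
    using pred by blast
  show thesis
  proof (rule that; unfold pred')
    show "adj x (parent \<gamma> x)" for x
      by (rule parent)
    show "successors adj \<omega> x = {y. parent \<gamma> y = x}" for x
      unfolding successors_def pred'
      using adj_not_parent[OF ray, of x] parent(1) adj_commute by auto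
    show "(parent \<gamma> ^^ n) x = x \<Longrightarrow> n = 0" for n x
      by (rule funpow_parent_aperiodic[OF ray])
  qed
qed

end


section \<open>Solid spaces of functions and Neumann series\<close>

text \<open>One interface for all exponents. The Fatou axioms stand in for completeness: pointwise
  limits of norm-bounded partial sums stay in the space.\<close>

locale solid_norm =
  fixes V :: "('a \<Rightarrow> complex) set" and N :: "('a \<Rightarrow> complex) \<Rightarrow> real" and k :: "'a \<Rightarrow> real"
  assumes N_nonneg: "f \<in> V \<Longrightarrow> 0 \<le> N f"
    and solid_mem: "f \<in> V \<Longrightarrow> (\<And>x. norm (g x) \<le> norm (f x)) \<Longrightarrow> g \<in> V"
    and solid_le: "f \<in> V \<Longrightarrow> (\<And>x. norm (g x) \<le> norm (f x)) \<Longrightarrow> N g \<le> N f"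
    and scale_mem: "f \<in> V \<Longrightarrow> (\<lambda>x. a * f x) \<in> V"
    and scale_eq: "f \<in> V \<Longrightarrow> N (\<lambda>x. a * f x) = norm a * N f"
    and add_mem: "f \<in> V \<Longrightarrow> g \<in> V \<Longrightarrow> (\<lambda>x. f x + g x) \<in> V"
    and add_le: "f \<in> V \<Longrightarrow> g \<in> V \<Longrightarrow> N (\<lambda>x. f x + g x) \<le> N f + N g"
    and Fatou_mem: "(\<And>n. F n \<in> V) \<Longrightarrow> (\<And>n. N (F n) \<le> c) \<Longrightarrow>
      (\<And>x. (\<lambda>n. F n x) \<longlonglongrightarrow> f x) \<Longrightarrow> f \<in> V"
    and Fatou_le: "(\<And>n. F n \<in> V) \<Longrightarrow> (\<And>n. N (F n) \<le> c) \<Longrightarrow>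
      (\<And>x. (\<lambda>n. F n x) \<longlonglongrightarrow> f x) \<Longrightarrow> N f \<le> c"
    and point_le: "f \<in> V \<Longrightarrow> norm (f x) \<le> k x * N f"
    and point_mass_mem: "(\<lambda>y. if y = x then 1 else 0) \<in> V"
begin

lemma zero_mem: "(\<lambda>x. 0) \<in> V"
  using scale_mem[OF point_mass_mem, of 0] by simp

lemma N_zero: "N (\<lambda>x. 0) = 0"
  using scale_eq[OF point_mass_mem, of 0] by simp

lemma lincomb_mem: "f \<in> V \<Longrightarrow> g \<in> V \<Longrightarrow> (\<lambda>x. a * f x + b * g x) \<in> V"
  by (intro add_mem scale_mem)

lemma diff_scale_mem: "f \<in> V \<Longrightarrow> g \<in> V \<Longrightarrow> (\<lambda>x. f x - b * g x) \<in> V"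
  using lincomb_mem[of f g 1 "- b"] by simp

lemma sum_mem:
  assumes "\<And>j. F j \<in> V"
  shows "(\<lambda>x. \<Sum>j<n::nat. F j x) \<in> V"
  using assms by (induction n) (simp_all add: zero_mem add_mem)

lemma sum_le:
  assumes "\<And>j. F j \<in> V"
  shows "N (\<lambda>x. \<Sum>j<n::nat. F j x) \<le> (\<Sum>j<n. N (F j))"
proof (induction n)
  case (Suc n)
  then show ?case
    using add_le[OF sum_mem[of F n] assms[of n], OF assms] by simp
qed (simp add: N_zero)

end

text \<open>\<open>P_lim\<close>, which averages over finite sets satisfy, carries \<open>P\<close>
  through the pointwise limit that defines a Neumann series.\<close>

locale solid_contraction = solid_norm +
  fixes P :: "('a \<Rightarrow> complex) \<Rightarrow> 'a \<Rightarrow> complex"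
  assumes P_linear: "P (\<lambda>x. a * f x + b * g x) = (\<lambda>x. a * P f x + b * P g x)"
    and P_mem: "f \<in> V \<Longrightarrow> P f \<in> V"
    and P_le: "f \<in> V \<Longrightarrow> N (P f) \<le> N f"
    and P_lim: "(\<And>x. (\<lambda>n. F n x) \<longlonglongrightarrow> f x) \<Longrightarrow> (\<lambda>n. P (F n) x) \<longlonglongrightarrow> P f x"
begin

lemma funpow_linear: "(P ^^ j) (\<lambda>x. a * f x + b * g x) = (\<lambda>x. a * (P ^^ j) f x + b * (P ^^ j) g x)"
  by (induction j) (simp_all add: P_linear)

lemma funpow_mem: "f \<in> V \<Longrightarrow> (P ^^ j) f \<in> V"
  by (induction j) (simp_all add: P_mem)

lemma funpow_le: "f \<in> V \<Longrightarrow> N ((P ^^ j) f) \<le> N f"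
  by (induction j) (auto intro: order_trans[OF P_le] funpow_mem)

lemma P_diff_scale: "P (\<lambda>x. f x - b * g x) = (\<lambda>x. P f x - b * P g x)"
  using P_linear[of 1 f "- b" g] by simp

lemma P_scale: "P (\<lambda>x. b * g x) = (\<lambda>x. b * P g x)"
  using P_linear[of b g 0 g] by simp

lemma P_sum: "P (\<lambda>x. \<Sum>j<n::nat. a j * F j x) = (\<lambda>x. \<Sum>j<n. a j * P (F j) x)"
proof (induction n)
  case 0
  then show ?case
    using P_scale[of 0 "\<lambda>x. 0"] by simp
next
  case (Suc n)
  then show ?case
    using P_linear[of 1 "\<lambda>x. \<Sum>j<n. a j * F j x" "a n" "F n"] by simp
qed

section \<open>Neumann series of a contraction\<close>

context
  fixes q :: complex
  assumes q: "norm q < 1"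
begin

definition neumann :: "('a \<Rightarrow> complex) \<Rightarrow> 'a \<Rightarrow> complex" where
  "neumann f x = (\<Sum>j. q ^ j * (P ^^ j) f x)"

lemma neumann_summable:
  assumes "f \<in> V"
  shows "summable (\<lambda>j. q ^ j * (P ^^ j) f x)"
proof (rule summable_comparison_test')
  \<comment> \<open>All powers of \<open>P\<close> are bounded by \<open>N f\<close>, and evaluation
    at \<open>x\<close> costs a factor \<open>k x\<close>, whose sign is not prescribed.\<close>
  show "summable (\<lambda>j. norm q ^ j * (\<bar>k x\<bar> * N f))"
    using q by (intro summable_mult2 summable_geometric) simp
  show "norm (q ^ j * (P ^^ j) f x) \<le> norm q ^ j * (\<bar>k x\<bar> * N f)" for j
  proof -
    have "norm ((P ^^ j) f x) \<le> k x * N ((P ^^ j) f)"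
      by (intro point_le funpow_mem assms)
    also have "\<dots> \<le> \<bar>k x\<bar> * N f"
      using funpow_le[OF assms, of j] N_nonneg[OF funpow_mem[OF assms, of j]]
      by (intro mult_mono) auto
    finally show ?thesis
      by (simp add: norm_mult norm_power mult_left_mono)
  qed
qed

lemma neumann_sums: "f \<in> V \<Longrightarrow> (\<lambda>j. q ^ j * (P ^^ j) f x) sums neumann f x"
  unfolding neumann_def by (rule summable_sums[OF neumann_summable])

lemma neumann_lim: "f \<in> V \<Longrightarrow> (\<lambda>n. \<Sum>j<n. q ^ j * (P ^^ j) f x) \<longlonglongrightarrow> neumann f x"
  using neumann_sums[of f x] unfolding sums_def .

lemma partial_sum_mem: "f \<in> V \<Longrightarrow> (\<lambda>x. \<Sum>j<n. q ^ j * (P ^^ j) f x) \<in> V"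
  by (intro sum_mem scale_mem funpow_mem)

lemma partial_sum_le:
  assumes "f \<in> V"
  shows "N (\<lambda>x. \<Sum>j<n. q ^ j * (P ^^ j) f x) \<le> 1 / (1 - norm q) * N f"
proof -
  have "N (\<lambda>x. \<Sum>j<n. q ^ j * (P ^^ j) f x) \<le> (\<Sum>j<n. N (\<lambda>x. q ^ j * (P ^^ j) f x))"
    by (intro sum_le scale_mem funpow_mem assms)
  also have "\<dots> \<le> (\<Sum>j<n. norm q ^ j * N f)"
    using assms by (intro sum_mono) (simp add: scale_eq funpow_mem norm_power mult_left_mono funpow_le)
  also have "\<dots> = (\<Sum>j<n. norm q ^ j) * N f"
    by (simp add: sum_distrib_right)
  also have "\<dots> \<le> (\<Sum>j. norm q ^ j) * N f"
    using q by (intro mult_right_mono N_nonneg assms sum_le_suminf summable_geometric) auto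
  also have "(\<Sum>j. norm q ^ j) = 1 / (1 - norm q)"
    using q by (intro suminf_geometric) simp
  finally show ?thesis .
qed

lemma neumann_mem: "f \<in> V \<Longrightarrow> neumann f \<in> V"
  by (rule Fatou_mem[OF partial_sum_mem partial_sum_le neumann_lim])

lemma neumann_le: "f \<in> V \<Longrightarrow> N (neumann f) \<le> 1 / (1 - norm q) * N f"
  by (rule Fatou_le[OF partial_sum_mem partial_sum_le neumann_lim])

lemma neumann_linear:
  assumes "f \<in> V" "g \<in> V"
  shows "neumann (\<lambda>x. a * f x + b * g x) = (\<lambda>x. a * neumann f x + b * neumann g x)"
proof
  fix x
  have "(\<lambda>j. a * (q ^ j * (P ^^ j) f x) + b * (q ^ j * (P ^^ j) g x)) sums
      (a * neumann f x + b * neumann g x)"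
    using assms by (intro sums_add sums_mult neumann_sums)
  then show "neumann (\<lambda>x. a * f x + b * g x) x = a * neumann f x + b * neumann g x"
    unfolding neumann_def[of "\<lambda>x. a * f x + b * g x"] funpow_linear
    by (intro sums_unique[symmetric]) (simp add: algebra_simps)
qed

lemma neumann_scale: "f \<in> V \<Longrightarrow> neumann (\<lambda>x. a * f x) = (\<lambda>x. a * neumann f x)"
  using neumann_linear[of f f a 0] by simp

lemma neumann_right_inverse:
  assumes "f \<in> V"
  shows "(\<lambda>x. neumann f x - q * P (neumann f) x) = f"
proof
  fix x
  let ?S = "\<lambda>n x. \<Sum>j<n. q ^ j * (P ^^ j) f x"
  \<comment> \<open>Partial sums of different lengths are compared, so that their difference is
    exactly the first term \<open>f x\<close>.\<close>
  have "(\<lambda>n. ?S (Suc n) x - q * P (?S n) x) \<longlonglongrightarrow> neumann f x - q * P (neumann f) x"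
    by (intro tendsto_intros LIMSEQ_Suc neumann_lim P_lim assms)
  moreover have "?S (Suc n) x - q * P (?S n) x = f x" for n
    by (simp only: P_sum sum.lessThan_Suc_shift) (simp add: sum_distrib_left mult.assoc)
  ultimately show "neumann f x - q * P (neumann f) x = f x"
    by (simp add: LIMSEQ_const_iff)
qed

lemma neumann_left_inverse:
  assumes "f \<in> V"
  shows "neumann (\<lambda>x. f x - q * P f x) = f"
proof
  fix x
  let ?u = "\<lambda>j. q ^ j * (P ^^ j) f x"
  have "(\<lambda>j. ?u j - ?u (Suc j)) sums (?u 0 - 0)"
    by (intro telescope_sums' summable_LIMSEQ_zero neumann_summable assms)
  moreover have "q ^ j * (P ^^ j) (\<lambda>x. f x - q * P f x) x = ?u j - ?u (Suc j)" for j
    using funpow_linear[of j 1 f "- q" "P f"] by (simp add: funpow_swap1 algebra_simps)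
  ultimately show "neumann (\<lambda>x. f x - q * P f x) x = f x"
    unfolding neumann_def by (simp add: sums_iff)
qed

end

end


section \<open>The spectrum of the symmetrized shift\<close>

text \<open>\<open>q\<close> and \<open>\<mu>\<close> are the roots of
  \<open>X^2 - 2 w X + 1\<close>. Their product is 1, so one of them lies in the open disc unless
  both have modulus one; then they are conjugate and \<open>w\<close> is the real part of
  \<open>q\<close>.\<close>

lemma joukowski_preimage:
  fixes w :: complex
  assumes "w \<notin> complex_of_real ` {-1..1}"
  obtains q where "q \<noteq> 0" "norm q < 1" "q\<^sup>2 + 1 = 2 * w * q"
proof -
  define s where "s = csqrt (w\<^sup>2 - 1)"
  define q where "q = w + s"
  define \<mu> where "\<mu> = w - s"
  have s: "s\<^sup>2 = w\<^sup>2 - 1"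
    unfolding s_def by simp
  have prod: "q * \<mu> = 1" and sum: "q + \<mu> = 2 * w"
    using s unfolding q_def \<mu>_def by (auto simp: algebra_simps power2_eq_square)
  have eqs: "q\<^sup>2 + 1 = 2 * w * q" "\<mu>\<^sup>2 + 1 = 2 * w * \<mu>"
    unfolding sum[symmetric] prod[symmetric] by (auto simp: algebra_simps power2_eq_square)
  have nz: "q \<noteq> 0" "\<mu> \<noteq> 0"
    using prod by auto
  have "norm q \<noteq> 1"
  proof
    assume 1: "norm q = 1"
    then have "q * cnj q = 1"
      using complex_norm_square[of q] by simp
    then have "\<mu> = cnj q"
      using prod nz by (metis mult_left_cancel)
    then have "w = of_real (Re q)"
      using sum complex_add_cnj[of q] by simp
    moreover have "Re q \<in> {-1..1}"
      using abs_Re_le_cmod[of q] 1 by auto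
    ultimately show False
      using assms by blast
  qed
  moreover have "norm \<mu> = inverse (norm q)"
    using prod nz by (metis inverse_unique norm_inverse)
  ultimately have "norm q < 1 \<or> norm \<mu> < 1"
    using nz by (auto intro!: inverse_less_1_iff[THEN iffD2])
  then show thesis
    using eqs nz that by blast
qed

text \<open>The operator \<open>T\<close> plays the role of the adjoint of the isometry \<open>f \<mapsto> f \<circ> p\<close>.\<close>

locale aperiodic_shift =
  S: solid_contraction V N k "\<lambda>f x. f (p x)" + T: solid_contraction V N k T
  for V :: "('a \<Rightarrow> complex) set" and N k p T +
  assumes T_shift: "T (\<lambda>x. f (p x)) = f"
    and aperiodic: "(p ^^ n) x = x \<Longrightarrow> n = 0"
begin

definition laplacian :: "('a \<Rightarrow> complex) \<Rightarrow> 'a \<Rightarrow> complex" where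
  "laplacian f x = f x - 1 / 2 * f (p x) - 1 / 2 * T f x"

text \<open>The Toeplitz factorization: for \<open>q + 1 / q = 2 (1 - z)\<close>, subtracting the Laplacian from \<open>z\<close>
  gives a multiple of \<open>(1 - q T) (1 - q S)\<close>, because \<open>T S = 1\<close>.\<close>

lemma laplacian_factorization:
  assumes "q \<noteq> 0" "q\<^sup>2 + 1 = 2 * (1 - z) * q"
  defines "u \<equiv> \<lambda>f x. f x - q * f (p x)"
  shows "z * f x - laplacian f x = - 1 / (2 * q) * (u f x - q * T (u f) x)"
proof -
  have "T (u f) x = T f x - q * f x"
    unfolding u_def by (simp add: T.P_diff_scale T_shift)
  moreover have "2 * q * (z * f x - laplacian f x) = (2 * q * z - 2 * q) * f x + q * f (p x) + q * T f x"
    unfolding laplacian_def by (simp add: algebra_simps)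
  moreover have "2 * q * z - 2 * q = - (q\<^sup>2 + 1)"
    unfolding assms(2) by (simp add: algebra_simps)
  ultimately have "2 * q * (z * f x - laplacian f x) = - (q\<^sup>2 + 1) * f x + q * f (p x) + q * T f x"
    and Tu: "T (u f) x = T f x - q * f x"
    by simp_all
  note this(1)
  also have "- (q\<^sup>2 + 1) * f x + q * f (p x) + q * T f x = - (u f x - q * (T f x - q * f x))"
    unfolding u_def by (simp add: algebra_simps power2_eq_square)
  also note Tu[symmetric]
  finally have "2 * q * (z * f x - laplacian f x) = - (u f x - q * T (u f) x)" .
  then show ?thesis
    using assms(1) by (simp add: field_simps)
qed

section \<open>The resolvent outside the interval\<close>

lemma resolvent_outside_interval:
  assumes "z \<notin> complex_of_real ` {0..2}"
  shows "z \<in> resolvent_set_on V N laplacian"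
proof -
  have "1 - z \<notin> complex_of_real ` {-1..1}"
  proof
    assume "1 - z \<in> complex_of_real ` {-1..1}"
    then obtain t where "1 - z = of_real t" "t \<in> {-1..1}"
      by blast
    then have "z = of_real (1 - t)" "1 - t \<in> {0..2}"
      by (auto simp: algebra_simps)
    then show False
      using assms by blast
  qed
  then obtain q where q: "q \<noteq> 0" "norm q < 1" "q\<^sup>2 + 1 = 2 * (1 - z) * q"
    by (rule joukowski_preimage)
  note factor = laplacian_factorization[OF q(1,3)]
  let ?GS = "S.neumann q" and ?GT = "T.neumann q"
  note mem = S.neumann_mem[OF q(2)] T.neumann_mem[OF q(2)]
  \<comment> \<open>The factorization is inverted in reverse order: first \<open>1 - q T\<close>,
    then \<open>1 - q S\<close>. The order matters, since \<open>S\<close> and \<open>T\<close> need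
    not commute.\<close>
  define R where "R f = (\<lambda>x. - 2 * q * ?GS (?GT f) x)" for f
  have R_mem: "R f \<in> V" if "f \<in> V" for f
    unfolding R_def using that by (intro S.scale_mem mem)
  have R_linear: "R (\<lambda>x. a * f x + b * g x) = (\<lambda>x. a * R f x + b * R g x)"
    if "f \<in> V" "g \<in> V" for f g a b
    using that unfolding R_def
    by (simp add: S.neumann_linear[OF q(2)] T.neumann_linear[OF q(2)] mem algebra_simps)
  have R_le: "N (R f) \<le> 2 * norm q * (1 / (1 - norm q) * (1 / (1 - norm q))) * N f"
    if "f \<in> V" for f
  proof -
    have "N (R f) = 2 * norm q * N (?GS (?GT f))"
      unfolding R_def using that by (subst S.scale_eq) (auto intro: mem simp: norm_mult)
    also have "N (?GS (?GT f)) \<le> 1 / (1 - norm q) * N (?GT f)"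
      using that by (intro S.neumann_le q mem)
    also have "N (?GT f) \<le> 1 / (1 - norm q) * N f"
      using that by (intro T.neumann_le q)
    finally show ?thesis
      using q(2) by (simp add: mult_left_mono divide_right_mono)
  qed
  have left: "R (\<lambda>x. z * f x - laplacian f x) = f" if f: "f \<in> V" for f
  proof -
    define u where "u = (\<lambda>x. f x - q * f (p x))"
    have u: "u \<in> V"
      unfolding u_def using f by (intro S.diff_scale_mem S.P_mem)
    have "(\<lambda>x. z * f x - laplacian f x) = (\<lambda>x. - 1 / (2 * q) * (u x - q * T u x))"
      unfolding factor u_def ..
    then have "?GT (\<lambda>x. z * f x - laplacian f x) = (\<lambda>x. - 1 / (2 * q) * ?GT (\<lambda>x. u x - q * T u x) x)"
      using u by (simp only: T.neumann_scale[OF q(2)] S.diff_scale_mem T.P_mem)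
    also have "?GT (\<lambda>x. u x - q * T u x) = u"
      by (intro T.neumann_left_inverse q u)
    finally have "?GS (?GT (\<lambda>x. z * f x - laplacian f x)) = (\<lambda>x. - 1 / (2 * q) * ?GS u x)"
      using u by (simp only: S.neumann_scale[OF q(2)])
    also have "?GS u = f"
      unfolding u_def by (intro S.neumann_left_inverse q f)
    finally show ?thesis
      unfolding R_def using q(1) by simp
  qed
  have right: "(\<lambda>x. z * R f x - laplacian (R f) x) = f" if f: "f \<in> V" for f
  proof -
    have GS: "?GS (?GT f) x - q * ?GS (?GT f) (p x) = ?GT f x" for x
      by (rule fun_cong[OF S.neumann_right_inverse[OF q(2) mem(2)[OF f]]])
    have u: "R f x - q * R f (p x) = - 2 * q * ?GT f x" for x
    proof -
      have "R f x - q * R f (p x) = - 2 * q * (?GS (?GT f) x - q * ?GS (?GT f) (p x))"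
        unfolding R_def by (simp add: algebra_simps)
      then show ?thesis
        by (simp only: GS)
    qed
    have "z * R f x - laplacian (R f) x =
        - 1 / (2 * q) * (- 2 * q * ?GT f x - q * (- 2 * q * T (?GT f) x))" for x
      unfolding factor u by (simp only: T.P_scale)
    also have "- 1 / (2 * q) * (- 2 * q * a - q * (- 2 * q * b)) = a - q * b" for a b
      using q(1) by (simp add: divide_simps) (simp add: algebra_simps)
    finally have "z * R f x - laplacian (R f) x = ?GT f x - q * T (?GT f) x" for x .
    then show ?thesis
      using T.neumann_right_inverse[OF q(2) f] by simp
  qed
  have "bounded_operator_on V N R"
    unfolding bounded_operator_on_def using R_mem R_linear R_le by blast
  with left right show ?thesis
    unfolding resolvent_set_on_def by blast
qed

section \<open>Functions of the generation below a vertex\<close>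

definition layered :: "'a \<Rightarrow> (nat \<Rightarrow> complex) \<Rightarrow> 'a \<Rightarrow> complex" where
  "layered v \<phi> x = (\<Sum>n | (p ^^ n) x = v. \<phi> n)"

text \<open>If \<open>i < j\<close>, then \<open>p ^^ (j - i)\<close> would fix \<open>v\<close>. So
  the sum in \<open>layered\<close> has at most one term: its value is \<open>\<phi> n\<close> on
  the \<open>n\<close>-th generation of descendants of \<open>v\<close> and 0 elsewhere.\<close>

lemma layer_unique:
  assumes "(p ^^ i) x = v" "(p ^^ j) x = v"
  shows "i = j"
proof -
  have le: "j \<le> i" if "(p ^^ i) x = v" "(p ^^ j) x = v" for i j
  proof (rule ccontr)
    assume "\<not> j \<le> i"
    then have "(p ^^ (j - i)) ((p ^^ i) x) = (p ^^ j) x"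
      by (metis comp_apply funpow_add le_add_diff_inverse2 nle_le)
    then have "(p ^^ (j - i)) v = v"
      using that by simp
    then show False
      using aperiodic \<open>\<not> j \<le> i\<close> by force
  qed
  show ?thesis
    using assms by (intro le_antisym le)
qed

lemma layered_eq:
  assumes "(p ^^ n) x = v"
  shows "layered v \<phi> x = \<phi> n"
proof -
  have "{n. (p ^^ n) x = v} = {n}"
    using layer_unique[OF assms] assms by blast
  then show ?thesis
    unfolding layered_def by simp
qed

lemma layered_eq_0: "(\<And>n. (p ^^ n) x \<noteq> v) \<Longrightarrow> layered v \<phi> x = 0"
  unfolding layered_def by simp

lemma layered_cases:
  obtains n where "(p ^^ n) x = v" "\<And>\<phi>. layered v \<phi> x = \<phi> n"
  | "\<And>n. (p ^^ n) x \<noteq> v" "\<And>\<phi>. layered v \<phi> x = 0"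
  using layered_eq layered_eq_0 by metis

lemma layered_lincomb:
  "layered v (\<lambda>n. a * \<phi> n + b * \<psi> n) x = a * layered v \<phi> x + b * layered v \<psi> x"
  by (rule layered_cases[of x v]) auto

lemma layered_mono:
  assumes "\<And>n. norm (\<phi> n) \<le> norm (\<psi> n)"
  shows "norm (layered v \<phi> x) \<le> norm (layered v \<psi> x)"
  using assms by (auto intro: layered_cases[of x v])

text \<open>\<open>x\<close> is one generation below \<open>p x\<close>. The prepended 0 is the
  value at \<open>v\<close> itself, because \<open>p v\<close> is not a descendant of
  \<open>v\<close>.\<close>

lemma layered_shift: "layered v \<phi> (p x) = layered v (case_nat 0 \<phi>) x"
proof (rule layered_cases[of "p x" v])
  fix n
  assume n: "(p ^^ n) (p x) = v" "\<And>\<phi>. layered v \<phi> (p x) = \<phi> n"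
  then have "(p ^^ Suc n) x = v"
    by (simp add: funpow_swap1)
  then show ?thesis
    using layered_eq[of "Suc n" x v] n by simp
next
  assume none: "\<And>n. (p ^^ n) (p x) \<noteq> v" "\<And>\<phi>. layered v \<phi> (p x) = 0"
  show ?thesis
  proof (rule layered_cases[of x v])
    fix n
    assume n: "(p ^^ n) x = v" "\<And>\<phi>. layered v \<phi> x = \<phi> n"
    have "n = 0"
    proof (cases n)
      case (Suc j)
      then show ?thesis
        using n(1) none(1)[of j] by (simp add: funpow_swap1)
    qed
    then show ?thesis
      using n(2) none(2) by simp
  qed (simp add: none(2))
qed

text \<open>A profile that vanishes at 0 is a right shift, and \<open>T S = 1\<close> undoes that
  shift.\<close>

lemma T_layered:
  assumes "\<phi> 0 = 0"
  shows "T (layered v \<phi>) = layered v (\<lambda>n. \<phi> (Suc n))"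
proof -
  have "\<phi> = case_nat 0 (\<lambda>n. \<phi> (Suc n))"
    using assms by (auto split: nat.splits)
  then have "layered v \<phi> = (\<lambda>x. layered v (\<lambda>n. \<phi> (Suc n)) (p x))"
    unfolding layered_shift by metis
  then show ?thesis
    by (simp only: T_shift)
qed

abbreviation layers :: "'a \<Rightarrow> nat \<Rightarrow> nat \<Rightarrow> 'a \<Rightarrow> complex" where
  "layers v i j \<equiv> layered v (\<lambda>n. of_bool (i \<le> n \<and> n \<le> j))"

text \<open>Starting from the point mass at \<open>v\<close>, each step adds generation 0 to the
  shifted layers; solidity then cuts off the generations before \<open>i\<close>.\<close>

lemma layers_mem: "layers v i j \<in> V"
proof -
  have "layers v 0 j \<in> V"
  proof (induction j)
    case 0
    have "layers v 0 0 x = (if x = v then 1 else 0)" for x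
    proof (cases "x = v")
      case True
      then show ?thesis
        using layered_eq[of 0 x v] by simp
    next
      case False
      then have "n \<noteq> 0" if "(p ^^ n) x = v" for n
        using that by (cases n) auto
      then show ?thesis
        using False by (cases rule: layered_cases[of x v]) auto
    qed
    then show ?case
      using S.point_mass_mem[of v] by presburger
  next
    case (Suc j)
    have *: "(of_bool (0 \<le> n \<and> n \<le> Suc j) :: complex) =
        1 * of_bool (0 \<le> n \<and> n \<le> 0) + 1 * case_nat 0 (\<lambda>n. of_bool (0 \<le> n \<and> n \<le> j)) n" for n
      by (auto split: nat.splits)
    have "layers v 0 (Suc j) = (\<lambda>x. 1 * layers v 0 0 x + 1 * layers v 0 j (p x))"
      unfolding layered_shift * layered_lincomb ..
    moreover have "layers v 0 0 \<in> V"
      using Suc by (rule S.solid_mem) (auto intro!: layered_mono)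
    ultimately show ?case
      using S.lincomb_mem[OF _ S.P_mem[OF Suc], of "layers v 0 0" 1 1] by (simp only:)
  qed
  then show ?thesis
    by (rule S.solid_mem) (auto intro!: layered_mono)
qed

lemma layered_mem:
  assumes "\<And>n. norm (\<phi> n) \<le> c * of_bool (n \<le> j)"
  shows "layered v \<phi> \<in> V"
proof (rule S.solid_mem)
  \<comment> \<open>The summand with factor 0 brings the bound into the shape of
    \<open>layered_lincomb\<close>.\<close>
  show "(\<lambda>x. of_real c * layers v 0 j x + 0 * layers v 0 j x) \<in> V"
    by (intro S.lincomb_mem layers_mem)
  fix x
  have "norm (\<phi> n) \<le> norm (of_real c * of_bool (0 \<le> n \<and> n \<le> j) + 0 * of_bool (0 \<le> n \<and> n \<le> j) :: complex)" for n
    using assms[of n] by auto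
  from layered_mono[OF this]
  show "norm (layered v \<phi> x) \<le> norm (of_real c * layers v 0 j x + 0 * layers v 0 j x)"
    by (subst (asm) layered_lincomb)
qed

text \<open>Composition with \<open>p\<close> moves the layers one generation down and
  \<open>T\<close> moves them back. Both are contractions, so neither changes the norm.\<close>

lemma N_layers_Suc: "N (layers v (Suc i) (Suc j)) = N (layers v i j)"
proof -
  have "case_nat 0 (\<lambda>n. of_bool (i \<le> n \<and> n \<le> j)) =
      (\<lambda>n. of_bool (Suc i \<le> n \<and> n \<le> Suc j) :: complex)"
    by (intro ext) (simp split: nat.split)
  then have "layers v (Suc i) (Suc j) = (\<lambda>x. layers v i j (p x))"
    by (simp only: layered_shift)
  moreover have "T (layers v (Suc i) (Suc j)) = layers v i j"
    by (subst T_layered) auto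
  ultimately show ?thesis
    using S.P_le[OF layers_mem, of v i j] T.P_le[OF layers_mem, of v "Suc i" "Suc j"] by simp
qed

lemma N_layers_add: "N (layers v (i + l) (j + l)) = N (layers v i j)"
  by (induction l) (auto simp: N_layers_Suc)

lemma N_layers_pos: "0 < N (layers v 0 j)"
proof -
  have "layers v 0 j v = 1"
    by (subst layered_eq[of 0]) auto
  then have "1 \<le> k v * N (layers v 0 j)"
    using S.point_le[OF layers_mem, of v 0 j v] by simp
  then show ?thesis
    using S.N_nonneg[OF layers_mem, of v 0 j] by (cases "N (layers v 0 j) = 0") auto
qed

text \<open>Multiplying the generalized eigenfunction \<open>q ^ n\<close> by a tent of height and width of order \<open>K\<close>
  gives an approximate eigenfunction with relative error of order \<open>1 / K\<close>, for any solid norm.\<close>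

lemma interval_subset_spectrum:
  assumes "t \<in> {0..2}"
  shows "of_real t \<in> spectrum_on V N laplacian"
proof (rule ccontr)
  assume "of_real t \<notin> spectrum_on V N laplacian"
  then obtain R where R: "bounded_operator_on V N R"
    "\<And>f. f \<in> V \<Longrightarrow> R (\<lambda>x. of_real t * f x - laplacian f x) = f"
    unfolding spectrum_on_def resolvent_set_on_def by auto
  then obtain C where C: "\<And>f. f \<in> V \<Longrightarrow> N (R f) \<le> C * N f"
    unfolding bounded_operator_on_def by blast
  \<comment> \<open>The tent will have norm at least \<open>K * ?a\<close> and its residual norm at
    most \<open>2 * ?a\<close>, which contradicts the bound \<open>C\<close> for this
    \<open>K\<close>.\<close>
  obtain K :: nat where K: "2 * \<bar>C\<bar> < real K"
    using reals_Archimedean2 by blast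
  define v :: 'a where "v = undefined"
  define q where "q = cis (arccos (1 - t))"
  have q: "norm q = 1" "q \<noteq> 0" "2 * q * of_real (1 - t) = q\<^sup>2 + 1"
  proof -
    have "q + cnj q = 2 * of_real (1 - t)"
      using assms by (simp add: q_def complex_eq_iff)
    moreover have "q * cnj q = 1"
      by (simp add: q_def cis_cnj cis_mult)
    ultimately show "2 * q * of_real (1 - t) = q\<^sup>2 + 1"
      by (metis (no_types, lifting) distrib_left mult.assoc mult.left_commute power2_eq_square)
  qed (auto simp: q_def)
  \<comment> \<open>Truncated subtraction makes the tent vanish from \<open>4 * K\<close> on;
    \<open>h 0 = 0\<close> is what \<open>T_layered\<close> asks for.\<close>
  define h :: "nat \<Rightarrow> real" where "h n = real (min n (4 * K - n))" for n
  define \<phi> where "\<phi> n = of_real (h n) * q ^ n" for n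
  define \<rho> where "\<rho> n = (of_real t - 1) * \<phi> n + 1 * (1 / 2 * case_nat 0 \<phi> n + 1 / 2 * \<phi> (Suc n))" for n
  let ?a = "N (layers v K (3 * K))"
  have \<phi>_norm: "norm (\<phi> n) = h n" for n
    using q(1) by (simp add: \<phi>_def norm_mult norm_power h_def)
  have f_mem: "layered v \<phi> \<in> V"
  proof (rule layered_mem)
    show "norm (\<phi> n) \<le> real (4 * K) * of_bool (n \<le> 4 * K)" for n
      unfolding \<phi>_norm h_def by (cases "n \<le> 4 * K") (simp_all del: of_nat_mult)
  qed
  have "T (layered v \<phi>) = layered v (\<lambda>n. \<phi> (Suc n))"
    by (rule T_layered) (simp add: \<phi>_def h_def)
  then have residual: "(\<lambda>x. of_real t * layered v \<phi> x - laplacian (layered v \<phi>) x) = layered v \<rho>"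
    unfolding laplacian_def layered_shift \<rho>_def layered_lincomb by (auto simp: algebra_simps)
  have \<rho>_le: "norm (\<rho> n) \<le> of_bool (n \<le> 4 * K)" for n
  proof (cases n)
    case 0
    \<comment> \<open>In generation 0 only half of \<open>\<phi> 1\<close> survives.\<close>
    have "h 1 \<le> 1"
      unfolding h_def by simp
    then show ?thesis
      using 0 \<phi>_norm[of 1] by (simp add: \<rho>_def \<phi>_def[of 0] h_def[of 0] norm_divide)
  next
    case (Suc j)
    \<comment> \<open>By the equation for \<open>q\<close>, only increments of the tent remain. Each
      is at most one in modulus, and both vanish for \<open>n\<close> beyond
      \<open>4 * K\<close>.\<close>
    let ?D = "of_real (h j - h n) + q\<^sup>2 * of_real (h (Suc n) - h n)"
    have "2 * (q * \<rho> n) = - (2 * q * of_real (1 - t)) * \<phi> n + q * \<phi> j + q * \<phi> (Suc n)"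
      unfolding \<rho>_def using Suc by (simp add: algebra_simps)
    also have "\<dots> = q ^ n * ?D"
      unfolding q(3) \<phi>_def using Suc by (simp add: algebra_simps power2_eq_square)
    finally have "norm (2 * (q * \<rho> n)) = norm (q ^ n * ?D)"
      by (rule arg_cong)
    then have "norm (\<rho> n) = 1 / 2 * norm ?D"
      by (simp add: norm_mult norm_power q(1) del: of_real_diff)
    also have "\<dots> \<le> 1 / 2 * (\<bar>h j - h n\<bar> + \<bar>h (Suc n) - h n\<bar>)"
      using norm_triangle_ineq[of "of_real (h j - h n)" "q\<^sup>2 * of_real (h (Suc n) - h n)"] q(1)
      by (simp add: norm_mult norm_power del: of_real_diff)
    also have "\<dots> \<le> of_bool (n \<le> 4 * K)"
      using Suc unfolding h_def by (auto simp: min_def)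
    finally show ?thesis .
  qed
  have \<rho>_mem: "layered v \<rho> \<in> V"
    by (rule layered_mem[of _ 1 "4 * K"]) (simp add: \<rho>_le)
  \<comment> \<open>Two windows of the same length as that of \<open>?a\<close> cover the support of
    the residual; by shift invariance each has norm \<open>?a\<close>.\<close>
  have "N (layered v \<rho>) \<le> N (\<lambda>x. 1 * layers v 0 (2 * K) x + 1 * layers v (2 * K) (4 * K) x)"
  proof (intro S.solid_le S.lincomb_mem layers_mem)
    fix x
    have "norm (\<rho> n) \<le> norm (1 * of_bool (0 \<le> n \<and> n \<le> 2 * K) + 1 * of_bool (2 * K \<le> n \<and> n \<le> 4 * K) :: complex)" for n
      by (rule order_trans[OF \<rho>_le]) auto
    from layered_mono[OF this]
    show "norm (layered v \<rho> x) \<le> norm (1 * layers v 0 (2 * K) x + 1 * layers v (2 * K) (4 * K) x)"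
      by (subst (asm) layered_lincomb)
  qed
  also have "\<dots> \<le> N (layers v 0 (2 * K)) + N (layers v (2 * K) (4 * K))"
    using S.add_le[OF layers_mem layers_mem, of v 0 "2 * K" v "2 * K" "4 * K"] by simp
  also have "\<dots> = 2 * ?a"
    using N_layers_add[of v 0 K "2 * K"] N_layers_add[of v K K "3 * K"]
    by (simp flip: mult_2)
  finally have \<rho>_N: "N (layered v \<rho>) \<le> 2 * ?a" .
  \<comment> \<open>On the generations from \<open>K\<close> to \<open>3 * K\<close> the tent has
    height at least \<open>K\<close>.\<close>
  have "real K * ?a = N (\<lambda>x. of_nat K * layers v K (3 * K) x)"
    by (simp add: S.scale_eq layers_mem)
  also have "\<dots> \<le> N (layered v \<phi>)"
  proof (rule S.solid_le[OF f_mem])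
    fix x
    have "norm (of_nat K * of_bool (K \<le> n \<and> n \<le> 3 * K) + 0 * \<phi> n :: complex) \<le> norm (\<phi> n)" for n
      unfolding \<phi>_norm h_def by auto
    then have "norm (layered v (\<lambda>n. of_nat K * of_bool (K \<le> n \<and> n \<le> 3 * K) + 0 * \<phi> n) x)
        \<le> norm (layered v \<phi> x)"
      by (rule layered_mono)
    then show "norm (of_nat K * layers v K (3 * K) x) \<le> norm (layered v \<phi> x)"
      unfolding layered_lincomb by simp
  qed
  also have "\<dots> = N (R (layered v \<rho>))"
    using R(2)[OF f_mem] residual by simp
  also have "\<dots> \<le> C * N (layered v \<rho>)"
    by (rule C[OF \<rho>_mem])
  also have "\<dots> \<le> \<bar>C\<bar> * (2 * ?a)"
    using \<rho>_N S.N_nonneg[OF \<rho>_mem] by (intro mult_mono) auto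
  finally have "real K * ?a \<le> 2 * \<bar>C\<bar> * ?a"
    by simp
  moreover have "?a > 0"
    using N_layers_pos[of v "2 * K"] N_layers_add[of v 0 K "2 * K"] by (simp flip: mult_2)
  ultimately show False
    using K by simp
qed

theorem spectrum_laplacian: "spectrum_on V N laplacian = complex_of_real ` {0..2}"
  using resolvent_outside_interval interval_subset_spectrum
  unfolding spectrum_on_def by blast

end


section \<open>Lebesgue spaces of a flow measure\<close>

text \<open>The axioms of a solid norm are checked on closed balls, where they become statements about
  suprema or integrals.\<close>

lemma solid_norm_from_balls:
  fixes V :: "('a \<Rightarrow> complex) set"
  assumes ball: "\<And>f c. 0 \<le> c \<Longrightarrow> B c f \<longleftrightarrow> f \<in> V \<and> N f \<le> c"
    and nonneg: "\<And>f. 0 \<le> N f"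
    and solid: "\<And>c f g. B c f \<Longrightarrow> (\<And>x. norm (g x) \<le> norm (f x)) \<Longrightarrow> B c g"
    and scale: "\<And>c a f. 0 \<le> c \<Longrightarrow> B c f \<Longrightarrow> B (norm a * c) (\<lambda>x. a * f x)"
    and add: "\<And>c d f g. 0 < c \<Longrightarrow> 0 < d \<Longrightarrow> B c f \<Longrightarrow> B d g \<Longrightarrow> B (c + d) (\<lambda>x. f x + g x)"
    and Fatou: "\<And>c F f. (\<And>n. B c (F n)) \<Longrightarrow> (\<And>x. (\<lambda>n. F n x) \<longlonglongrightarrow> f x) \<Longrightarrow> B c f"
    and point: "\<And>c f x. 0 \<le> c \<Longrightarrow> B c f \<Longrightarrow> norm (f x) \<le> k x * c"
    and point_mass: "\<And>x. \<exists>c\<ge>0. B c (\<lambda>y. if y = x then 1 else 0)"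
  shows "solid_norm V N k"
proof
  have ballN: "B (N f) f" if "f \<in> V" for f
    using ball[OF nonneg] that by blast
  have mem: "f \<in> V" and le: "N f \<le> c" if "0 \<le> c" "B c f" for f c
    using ball that by blast+
  fix f g :: "'a \<Rightarrow> complex" and a :: complex and x :: 'a
  show "0 \<le> N f"
    by (rule nonneg)
  show "(\<lambda>y. if y = x then 1 else 0) \<in> V"
    using point_mass mem by blast
  assume f: "f \<in> V"
  show "g \<in> V" "N g \<le> N f" if "\<And>x. norm (g x) \<le> norm (f x)"
    using solid[OF ballN[OF f] that] mem le nonneg by blast+
  show "norm (f x) \<le> k x * N f"
    by (rule point[OF nonneg ballN[OF f]])
  have scale': "(\<lambda>x. a * f x) \<in> V" "N (\<lambda>x. a * f x) \<le> norm a * N f" if "f \<in> V" for a f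
    using scale[OF nonneg ballN[OF that]] mem le nonneg by (meson mult_nonneg_nonneg norm_ge_zero)+
  show "(\<lambda>x. a * f x) \<in> V"
    by (rule scale'[OF f])
  show "N (\<lambda>x. a * f x) = norm a * N f"
  proof (cases "a = 0")
    case True
    then show ?thesis
      using scale'(2)[OF f, of a] nonneg[of "\<lambda>x. a * f x"] by simp
  next
    case False
    \<comment> \<open>The reverse inequality is the upper bound for the inverse scalar.\<close>
    have "N f \<le> norm (inverse a) * N (\<lambda>x. a * f x)"
      using scale'(2)[OF scale'(1)[OF f, of a], of "inverse a"] False by (simp add: mult.assoc[symmetric])
    then have "norm a * N f \<le> N (\<lambda>x. a * f x)"
      using False by (simp add: norm_inverse norm_divide field_simps)
    then show ?thesis
      using scale'(2)[OF f, of a] by simp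
  qed
  assume g: "g \<in> V"
  \<comment> \<open>The slack \<open>e / 2\<close> makes both radii positive, as \<open>add\<close>
    demands, even when a norm is 0.\<close>
  have sum: "B ((N f + e / 2) + (N g + e / 2)) (\<lambda>x. f x + g x)" if "e > 0" for e
    using that f g ball[of "N f + e / 2" f] ball[of "N g + e / 2" g] nonneg[of f] nonneg[of g]
    by (intro add) auto
  show "(\<lambda>x. f x + g x) \<in> V"
    using sum[of 1] nonneg[of f] nonneg[of g] by (intro mem[of "N f + 1 / 2 + (N g + 1 / 2)"]) auto
  show "N (\<lambda>x. f x + g x) \<le> N f + N g"
  proof (rule field_le_epsilon)
    fix e :: real
    assume "e > 0"
    then have "N (\<lambda>x. f x + g x) \<le> (N f + e / 2) + (N g + e / 2)"
      using nonneg[of f] nonneg[of g] by (intro le sum) auto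
    then show "N (\<lambda>x. f x + g x) \<le> N f + N g + e"
      by simp
  qed
next
  fix F :: "nat \<Rightarrow> 'a \<Rightarrow> complex" and f c
  assume F: "\<And>n. F n \<in> V" "\<And>n. N (F n) \<le> c" "\<And>x. (\<lambda>n. F n x) \<longlonglongrightarrow> f x"
  have "0 \<le> c"
    using F(2)[of 0] nonneg[of "F 0"] by simp
  have "B c (F n)" for n
    using ball[OF \<open>0 \<le> c\<close>] F by blast
  then have "B c f"
    using Fatou F(3) by blast
  then show "f \<in> V" "N f \<le> c"
    using ball[OF \<open>0 \<le> c\<close>] by blast+
qed

text \<open>For two positive arguments this is \<open>powr_convex\<close>; if one is 0, it comes
  down to \<open>t powr p \<le> t\<close> for \<open>0 < t < 1\<close>.\<close>

lemma powr_convex_nonneg: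
  fixes p :: real
  assumes "1 \<le> p"
  shows "convex_on {0..} (\<lambda>x. x powr p)"
proof (rule convex_onI)
  have zero: "(t * y) powr p \<le> t * y powr p" if "0 < t" "t < 1" "0 \<le> y" for t y :: real
  proof -
    have "t powr p \<le> t powr 1"
      using assms that by (intro powr_mono') auto
    then show ?thesis
      using that by (simp add: powr_mult mult_right_mono)
  qed
  fix t x y :: real
  assume t: "0 < t" "t < 1" and xy: "x \<in> {0..}" "y \<in> {0..}"
  show "((1 - t) *\<^sub>R x + t *\<^sub>R y) powr p \<le> (1 - t) * x powr p + t * y powr p"
  proof (cases "x = 0 \<or> y = 0")
    case True
    then show ?thesis
      using zero[of t y] zero[of "1 - t" x] t xy assms by auto
  next
    case False
    then show ?thesis
      using convex_onD[OF powr_convex[OF assms], of t x y] t xy by auto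
  qed
qed (simp add: convex_real_interval)

lemma powr_le_iff:
  fixes r c p :: real
  assumes "0 \<le> r" "0 \<le> c" "0 < p"
  shows "r powr (1 / p) \<le> c \<longleftrightarrow> r \<le> c powr p"
proof -
  have "r powr (1 / p) \<le> c \<longleftrightarrow> (r powr (1 / p)) powr p \<le> c powr p"
    using assms by (meson powr_ge_zero powr_less_cancel_iff powr_mono2 powr_less_mono2 not_le less_imp_le)
  then show ?thesis
    using assms by (simp add: powr_powr)
qed

text \<open>\<open>enn2real\<close> sends infinity to 0, so finiteness has to accompany the bound on
  the real value.\<close>

lemma le_ennreal_iff: "0 \<le> c \<Longrightarrow> s \<le> ennreal c \<longleftrightarrow> s < \<infinity> \<and> enn2real s \<le> c"
  by (cases s) (auto simp: top_unique)

section \<open>Lebesgue norms for a weighted counting measure\<close>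

locale weighted_Lp =
  fixes m :: "'a \<Rightarrow> real" and p :: ennreal
  assumes weight_pos: "0 < m x" and exponent_ge_1: "1 \<le> p"
begin

abbreviation M :: "'a measure" where "M \<equiv> flow_measure m"

abbreviation r :: real where "r \<equiv> enn2real p"

lemma exponent: "p \<noteq> \<infinity> \<Longrightarrow> 1 \<le> r"
  using exponent_ge_1 enn2real_mono[of 1 p] by (simp add: top.not_eq_extremum)

lemma measurable_M [measurable, simp]: "f \<in> borel_measurable M"
  unfolding flow_measure_def by simp

lemma nn_integral_M: "(\<integral>\<^sup>+x. g x \<partial>M) = (\<integral>\<^sup>+x. ennreal (m x) * g x \<partial>count_space UNIV)"
  unfolding flow_measure_def by (rule nn_integral_density) auto

lemma AE_M: "(AE x in M. P x) \<longleftrightarrow> (\<forall>x. P x)"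
  unfolding flow_measure_def using weight_pos by (simp add: AE_density AE_count_space)

lemma esssup_M: "esssup M g = (SUP x. g x)" for g :: "'a \<Rightarrow> ennreal"
proof (rule antisym)
  show "esssup M g \<le> (SUP x. g x)"
    by (intro esssup_I measurable_M) (auto simp: AE_M intro: SUP_upper)
  show "(SUP x. g x) \<le> esssup M g"
    using esssup_AE[of g M] by (auto simp: AE_M intro: SUP_least)
qed

text \<open>A bound on a nonnegative integral contains integrability, so membership and norm bound
  become a single inequality.\<close>

definition Lp_ball :: "real \<Rightarrow> ('a \<Rightarrow> complex) \<Rightarrow> bool" where
  "Lp_ball c f \<longleftrightarrow> (if p = \<infinity> then \<forall>x. norm (f x) \<le> c
     else (\<integral>\<^sup>+x. ennreal (norm (f x) powr r) \<partial>M) \<le> ennreal (c powr r))"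

lemma Lp_ball_iff:
  assumes "0 \<le> c"
  shows "Lp_ball c f \<longleftrightarrow> f \<in> Lp_space M p \<and> Lp_norm M p f \<le> c"
proof (cases "p = \<infinity>")
  case True
  let ?s = "SUP x. ennreal (norm (f x))"
  have "(\<forall>x. norm (f x) \<le> c) \<longleftrightarrow> ?s \<le> ennreal c"
    using assms by (simp add: SUP_le_iff)
  also have "\<dots> \<longleftrightarrow> ?s < \<infinity> \<and> enn2real ?s \<le> c"
    by (rule le_ennreal_iff[OF assms])
  finally show ?thesis
    unfolding Lp_ball_def Lp_space_def Lp_norm_def esssup_M by (simp add: True)
next
  case False
  let ?I = "\<integral>\<^sup>+x. ennreal (norm (f x) powr r) \<partial>M"
  have "?I \<le> ennreal (c powr r) \<longleftrightarrow> ?I < \<infinity> \<and> enn2real ?I \<le> c powr r"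
    by (rule le_ennreal_iff) simp
  also have "\<dots> \<longleftrightarrow> ?I < \<infinity> \<and> enn2real ?I powr (1 / r) \<le> c"
    using exponent[OF False] assms by (simp add: powr_le_iff)
  finally show ?thesis
    using False
    by (simp add: Lp_ball_def Lp_space_def Lp_norm_def integrable_iff_bounded integral_eq_nn_integral)
qed

lemma Lp_norm_nonneg: "0 \<le> Lp_norm M p f"
  unfolding Lp_norm_def by simp

lemma Lp_ball_solid:
  assumes "Lp_ball c f" "\<And>x. norm (g x) \<le> norm (f x)"
  shows "Lp_ball c g"
proof (cases "p = \<infinity>")
  case True
  then show ?thesis
    using assms unfolding Lp_ball_def by (auto intro: order_trans)
next
  case False
  have "(\<integral>\<^sup>+x. ennreal (norm (g x) powr r) \<partial>M) \<le> (\<integral>\<^sup>+x. ennreal (norm (f x) powr r) \<partial>M)"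
    using assms(2) exponent[OF False] by (intro nn_integral_mono ennreal_leI powr_mono2) auto
  then show ?thesis
    using assms(1) False order_trans unfolding Lp_ball_def by auto
qed

lemma Lp_ball_scale:
  assumes "0 \<le> c" "Lp_ball c f"
  shows "Lp_ball (norm a * c) (\<lambda>x. a * f x)"
proof (cases "p = \<infinity>")
  case True
  then show ?thesis
    using assms unfolding Lp_ball_def by (simp add: norm_mult mult_left_mono)
next
  case False
  have "(\<integral>\<^sup>+x. ennreal (norm (a * f x) powr r) \<partial>M) =
      ennreal (norm a powr r) * (\<integral>\<^sup>+x. ennreal (norm (f x) powr r) \<partial>M)"
    by (subst nn_integral_cmult[symmetric]) (auto simp: norm_mult powr_mult ennreal_mult)
  also have "\<dots> \<le> ennreal (norm a powr r) * ennreal (c powr r)"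
    using assms(2) False unfolding Lp_ball_def by (intro mult_left_mono) auto
  also have "\<dots> = ennreal ((norm a * c) powr r)"
    using assms(1) by (simp add: powr_mult ennreal_mult)
  finally show ?thesis
    using False by (simp add: Lp_ball_def)
qed

text \<open>Minkowski's inequality, from convexity of the power function.\<close>

lemma Lp_ball_add:
  assumes "0 < c" "0 < d" "Lp_ball c f" "Lp_ball d g"
  shows "Lp_ball (c + d) (\<lambda>x. f x + g x)"
proof (cases "p = \<infinity>")
  case True
  then show ?thesis
    using assms unfolding Lp_ball_def by (simp add: norm_triangle_mono)
next
  case False
  \<comment> \<open>\<open>(|f| + |g|) / (c + d)\<close> is the convex combination of
    \<open>|f| / c\<close> and \<open>|g| / d\<close> with weights \<open>1 - t\<close> and
    \<open>t\<close>. The constants satisfy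
    \<open>A * c powr r + B * d powr r = (c + d) powr r\<close>.\<close>
  define t where "t = d / (c + d)"
  define A where "A = (1 - t) * (c + d) powr r / c powr r"
  define B where "B = t * (c + d) powr r / d powr r"
  have t: "0 \<le> t" "t \<le> 1" "1 - t = c / (c + d)"
    using assms(1,2) by (auto simp: t_def field_simps)
  have AB: "0 \<le> A" "0 \<le> B"
    using t(1,2) by (auto simp: A_def B_def)
  have pointwise: "norm (f x + g x) powr r \<le> A * norm (f x) powr r + B * norm (g x) powr r" for x
  proof -
    have "(norm (f x) + norm (g x)) / (c + d) = (1 - t) * (norm (f x) / c) + t * (norm (g x) / d)"
      using assms(1,2) unfolding t(3) by (simp add: t_def add_divide_distrib)
    then have "((norm (f x) + norm (g x)) / (c + d)) powr r \<le>
        (1 - t) * (norm (f x) / c) powr r + t * (norm (g x) / d) powr r"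
      using convex_onD[OF powr_convex_nonneg[OF exponent[OF False]], of t "norm (f x) / c" "norm (g x) / d"]
        assms(1,2) t(1,2) by simp
    then have "(norm (f x) + norm (g x)) powr r \<le>
        (c + d) powr r * ((1 - t) * (norm (f x) / c) powr r + t * (norm (g x) / d) powr r)"
      using assms(1,2) by (simp add: powr_divide divide_le_eq mult.commute)
    also have "\<dots> = A * norm (f x) powr r + B * norm (g x) powr r"
      unfolding A_def B_def using assms(1,2) by (simp add: powr_divide distrib_left mult_ac)
    finally show ?thesis
      using norm_triangle_ineq[of "f x" "g x"] exponent[OF False]
      by (meson norm_ge_zero order_trans powr_mono2 zero_le_one)
  qed
  have "(\<integral>\<^sup>+x. ennreal (norm (f x + g x) powr r) \<partial>M) \<le>
      (\<integral>\<^sup>+x. ennreal A * ennreal (norm (f x) powr r) + ennreal B * ennreal (norm (g x) powr r) \<partial>M)"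
    using pointwise AB by (intro nn_integral_mono) (simp add: ennreal_leI flip: ennreal_mult ennreal_plus)
  also have "\<dots> = ennreal A * (\<integral>\<^sup>+x. ennreal (norm (f x) powr r) \<partial>M) +
      ennreal B * (\<integral>\<^sup>+x. ennreal (norm (g x) powr r) \<partial>M)"
    by (simp add: nn_integral_add nn_integral_cmult)
  also have "\<dots> \<le> ennreal A * ennreal (c powr r) + ennreal B * ennreal (d powr r)"
    using assms(3,4) False unfolding Lp_ball_def by (intro add_mono mult_left_mono) auto
  also have "\<dots> = ennreal (A * c powr r + B * d powr r)"
    using AB by (simp add: ennreal_mult ennreal_plus)
  also have "A * c powr r + B * d powr r = (1 - t) * (c + d) powr r + t * (c + d) powr r"
    unfolding A_def B_def using assms(1,2) by simp
  also have "\<dots> = (c + d) powr r"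
    by (simp add: algebra_simps)
  finally show ?thesis
    using False by (simp add: Lp_ball_def)
qed

lemma Lp_ball_Fatou:
  assumes "\<And>n. Lp_ball c (F n)" "\<And>x. (\<lambda>n. F n x) \<longlonglongrightarrow> f x"
  shows "Lp_ball c f"
proof (cases "p = \<infinity>")
  case True
  have "norm (f x) \<le> c" for x
    using assms(1) True unfolding Lp_ball_def
    by (intro LIMSEQ_le_const2[OF tendsto_norm[OF assms(2)]]) auto
  then show ?thesis
    unfolding Lp_ball_def by (simp add: True)
next
  case False
  have "(\<lambda>n. ennreal (norm (F n x) powr r)) \<longlonglongrightarrow> ennreal (norm (f x) powr r)" for x
    using exponent[OF False]
    by (intro tendsto_ennrealI tendsto_powr' tendsto_norm assms(2) tendsto_const) auto
  then have "(\<integral>\<^sup>+x. ennreal (norm (f x) powr r) \<partial>M) =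
      (\<integral>\<^sup>+x. liminf (\<lambda>n. ennreal (norm (F n x) powr r)) \<partial>M)"
    by (intro nn_integral_cong lim_imp_Liminf[symmetric]) auto
  also have "\<dots> \<le> liminf (\<lambda>n. \<integral>\<^sup>+x. ennreal (norm (F n x) powr r) \<partial>M)"
    by (rule nn_integral_liminf) auto
  also have "\<dots> \<le> ennreal (c powr r)"
    using assms(1) False unfolding Lp_ball_def by (intro Liminf_le) auto
  finally show ?thesis
    using False by (simp add: Lp_ball_def)
qed

text \<open>The reciprocal of the norm of the point mass at \<open>x\<close>.\<close>

definition point_const :: "'a \<Rightarrow> real" where
  "point_const x = (if p = \<infinity> then 1 else (1 / m x) powr (1 / r))"

lemma nn_integral_M_point:
  "(\<integral>\<^sup>+y. (if y = x then g else 0) \<partial>M) = ennreal (m x) * g"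
proof -
  have "(\<integral>\<^sup>+y. (if y = x then g else 0) \<partial>M) = (\<integral>\<^sup>+y. ennreal (m x) * g * indicator {x} y \<partial>count_space UNIV)"
    unfolding nn_integral_M by (intro nn_integral_cong) (auto simp: indicator_def)
  then show ?thesis
    by (simp add: nn_integral_cmult_indicator)
qed

lemma Lp_ball_point:
  assumes "0 \<le> c" "Lp_ball c f"
  shows "norm (f x) \<le> point_const x * c"
proof (cases "p = \<infinity>")
  case True
  then show ?thesis
    using assms unfolding Lp_ball_def point_const_def by (simp add: True)
next
  case False
  have "ennreal (m x * norm (f x) powr r) = (\<integral>\<^sup>+y. (if y = x then ennreal (norm (f x) powr r) else 0) \<partial>M)"
    using weight_pos[of x] by (simp add: nn_integral_M_point ennreal_mult)
  also have "\<dots> \<le> (\<integral>\<^sup>+y. ennreal (norm (f y) powr r) \<partial>M)"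
    by (intro nn_integral_mono) auto
  also have "\<dots> \<le> ennreal (c powr r)"
    using assms False by (simp add: Lp_ball_def)
  finally have "norm (f x) powr r \<le> 1 / m x * c powr r"
    using weight_pos[of x] by (simp add: field_simps)
  also have "\<dots> = (point_const x * c) powr r"
    using exponent[OF False] assms(1) weight_pos[of x] False
    by (simp add: point_const_def powr_mult powr_powr)
  finally have "(norm (f x) powr r) powr (1 / r) \<le> point_const x * c"
    using exponent[OF False] assms(1) by (subst powr_le_iff) (auto simp: point_const_def)
  then show ?thesis
    using exponent[OF False] by (simp add: powr_powr)
qed

lemma Lp_ball_point_mass: "\<exists>c\<ge>0. Lp_ball c (\<lambda>y. if y = x then 1 else 0)"
proof (cases "p = \<infinity>")
  case True
  then show ?thesis
    unfolding Lp_ball_def by (intro exI[of _ 1]) simp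
next
  case False
  have "(\<integral>\<^sup>+y. ennreal (norm (if y = x then 1 else 0 :: complex) powr r) \<partial>M) =
      (\<integral>\<^sup>+y. (if y = x then 1 else 0) \<partial>M)"
    using exponent[OF False] by (intro nn_integral_cong) auto
  also have "\<dots> = ennreal ((m x powr (1 / r)) powr r)"
    using exponent[OF False] weight_pos[of x] by (simp add: nn_integral_M_point powr_powr)
  finally show ?thesis
    using False by (intro exI[of _ "m x powr (1 / r)"]) (simp add: Lp_ball_def)
qed

lemma solid_norm_Lp: "solid_norm (Lp_space M p) (Lp_norm M p) point_const"
proof (rule solid_norm_from_balls)
  show "0 \<le> c \<Longrightarrow> Lp_ball c f \<longleftrightarrow> f \<in> Lp_space M p \<and> Lp_norm M p f \<le> c" for f c
    by (rule Lp_ball_iff)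
qed (fact Lp_norm_nonneg Lp_ball_solid Lp_ball_scale Lp_ball_add Lp_ball_Fatou
    Lp_ball_point Lp_ball_point_mass)+

text \<open>Jensen's inequality reduces all exponents to the hypothesis on integrals.\<close>

lemma average_contraction_Lp:
  fixes Q :: "'a \<Rightarrow> 'a set" and w :: "'a \<Rightarrow> 'a \<Rightarrow> real"
  assumes finite: "\<And>x. finite (Q x)"
    and nonneg: "\<And>x y. 0 \<le> w x y"
    and sum_1: "\<And>x. (\<Sum>y\<in>Q x. w x y) = 1"
    and integral_le: "\<And>h. (\<integral>\<^sup>+x. (\<Sum>y\<in>Q x. ennreal (w x y) * h y) \<partial>M) \<le> (\<integral>\<^sup>+x. h x \<partial>M)"
  shows "solid_contraction (Lp_space M p) (Lp_norm M p) point_const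
    (\<lambda>f x. \<Sum>y\<in>Q x. of_real (w x y) * f y)" (is "solid_contraction _ _ _ ?P")
proof -
  have nonempty: "Q x \<noteq> {}" for x
    using sum_1[of x] by auto
  have norm_P: "norm (?P f x) \<le> (\<Sum>y\<in>Q x. w x y * norm (f y))" for f x
    using nonneg by (intro sum_norm_le) (simp add: norm_mult)
  have ball: "Lp_ball c (?P f)" if "0 \<le> c" "Lp_ball c f" for c f
  proof (cases "p = \<infinity>")
    case True
    have "norm (?P f x) \<le> c" for x
    proof -
      note norm_P[of x f]
      also have "(\<Sum>y\<in>Q x. w x y * norm (f y)) \<le> (\<Sum>y\<in>Q x. w x y * c)"
        using that True nonneg unfolding Lp_ball_def by (intro sum_mono mult_left_mono) auto
      also have "\<dots> = c"
        using sum_1 by (simp flip: sum_distrib_right)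
      finally show ?thesis .
    qed
    then show ?thesis
      unfolding Lp_ball_def by (simp add: True)
  next
    case False
    have "norm (?P f x) powr r \<le> (\<Sum>y\<in>Q x. w x y * norm (f y) powr r)" for x
    proof -
      have "norm (?P f x) powr r \<le> (\<Sum>y\<in>Q x. w x y * norm (f y)) powr r"
        using exponent[OF False] by (intro powr_mono2 norm_P) auto
      also have "\<dots> \<le> (\<Sum>y\<in>Q x. w x y * norm (f y) powr r)"
        using convex_on_sum[where y = "\<lambda>y. norm (f y)", OF finite[of x] nonempty[of x]
            powr_convex_nonneg[OF exponent[OF False]] sum_1[of x] nonneg] by simp
      finally show ?thesis .
    qed
    then have "(\<integral>\<^sup>+x. ennreal (norm (?P f x) powr r) \<partial>M) \<le>
        (\<integral>\<^sup>+x. (\<Sum>y\<in>Q x. ennreal (w x y) * ennreal (norm (f y) powr r)) \<partial>M)"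
      using nonneg by (intro nn_integral_mono) (simp add: ennreal_leI sum_ennreal flip: ennreal_mult)
    also have "\<dots> \<le> (\<integral>\<^sup>+x. ennreal (norm (f x) powr r) \<partial>M)"
      by (rule integral_le)
    also have "\<dots> \<le> ennreal (c powr r)"
      using that False by (simp add: Lp_ball_def)
    finally show ?thesis
      using False by (simp add: Lp_ball_def)
  qed
  show ?thesis
  proof (intro solid_contraction.intro solid_norm_Lp solid_contraction_axioms.intro)
    fix f g :: "'a \<Rightarrow> complex" and a b x and F :: "nat \<Rightarrow> 'a \<Rightarrow> complex"
    show "?P (\<lambda>x. a * f x + b * g x) = (\<lambda>x. a * ?P f x + b * ?P g x)"
      by (simp add: sum.distrib sum_distrib_left algebra_simps)
    show "?P f \<in> Lp_space M p" "Lp_norm M p (?P f) \<le> Lp_norm M p f" if "f \<in> Lp_space M p"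
      using ball[OF Lp_norm_nonneg, of f] that Lp_ball_iff[OF Lp_norm_nonneg] by blast+
    show "(\<lambda>n. ?P (F n) x) \<longlonglongrightarrow> ?P f x" if "\<And>x. (\<lambda>n. F n x) \<longlonglongrightarrow> f x"
      by (intro tendsto_intros that)
  qed
qed

end

text \<open>Each \<open>y\<close> lies in exactly one fibre, so exchanging the two integrals counts
  \<open>g y\<close> once.\<close>

lemma nn_integral_count_space_fibres:
  fixes g :: "'a \<Rightarrow> ennreal" and \<pi> :: "'a \<Rightarrow> 'b"
  assumes "\<And>x. finite {y. \<pi> y = x}"
  shows "(\<integral>\<^sup>+x. (\<Sum>y | \<pi> y = x. g y) \<partial>count_space UNIV) = (\<integral>\<^sup>+y. g y \<partial>count_space UNIV)"
proof -
  let ?k = "\<lambda>(x, y). g y * indicator {x} (\<pi> y)"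
  have "(\<Sum>y | \<pi> y = x. g y) = (\<integral>\<^sup>+y. ?k (x, y) \<partial>count_space UNIV)" for x
    using assms[of x] by (subst nn_integral_count_space'[of "{y. \<pi> y = x}"]) auto
  then have "(\<integral>\<^sup>+x. (\<Sum>y | \<pi> y = x. g y) \<partial>count_space UNIV) =
      (\<integral>\<^sup>+x. \<integral>\<^sup>+y. ?k (x, y) \<partial>count_space UNIV \<partial>count_space UNIV)"
    by simp
  also have "\<dots> = (\<integral>\<^sup>+y. \<integral>\<^sup>+x. ?k (x, y) \<partial>count_space UNIV \<partial>count_space UNIV)"
    by (simp only: nn_integral_fst_count_space nn_integral_snd_count_space)
  also have "\<dots> = (\<integral>\<^sup>+y. g y \<partial>count_space UNIV)"
    by (intro nn_integral_cong, subst nn_integral_count_space'[of "{\<pi> _}"]) (auto simp: indicator_def)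
  finally show ?thesis .
qed

section \<open>The flow Laplacian as a symmetrized shift\<close>

theorem corollary5p9:
  fixes adj :: "'a \<Rightarrow> 'a \<Rightarrow> bool" and \<omega> :: "(nat \<Rightarrow> 'a) set" and m :: "'a \<Rightarrow> real"
    and p :: ennreal
  assumes "flow_tree adj \<omega> m" and "1 \<le> p"
  shows "spectrum_on (Lp_space (flow_measure m) p) (Lp_norm (flow_measure m) p)
           (flow_laplacian adj \<omega> m) = complex_of_real ` {0..2}"
proof -
  interpret flow_tree adj \<omega> m
    by fact
  interpret weighted_Lp m p
    using flow_pos assms(2) by unfold_locales
  define \<pi> where "\<pi> = predecessor adj \<omega>"
  define T where "T f x = (\<Sum>y | \<pi> y = x. of_real (m y / m x) * f y)" for f :: "'a \<Rightarrow> complex" and x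
  obtain \<pi>: "\<And>x. adj x (\<pi> x)" "\<And>x. successors adj \<omega> x = {y. \<pi> y = x}"
    "\<And>n x. (\<pi> ^^ n) x = x \<Longrightarrow> n = 0"
    using predecessor_structure unfolding \<pi>_def by blast
  have finite: "finite {y. \<pi> y = x}" for x
    by (rule finite_subset[OF _ locally_finite[of x]]) (use \<pi>(1) adj_commute in blast)
  have m_sum: "(\<Sum>y | \<pi> y = x. m y) = m x" for x
    using flow_eq[of x] \<pi>(2) by simp
  have weights: "(\<Sum>y | \<pi> y = x. m y / m x) = 1" for x
    using m_sum[of x] flow_pos[of x] by (simp flip: sum_divide_distrib)
  \<comment> \<open>Composition with \<open>\<pi>\<close> is the average over
    \<open>{\<pi> x}\<close> with weight 1.\<close>
  have "solid_contraction (Lp_space M p) (Lp_norm M p) point_const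
      (\<lambda>f x. \<Sum>y\<in>{\<pi> x}. of_real ((\<lambda>_ _. 1) x y) * f y)"
  proof (rule average_contraction_Lp)
    fix h :: "'a \<Rightarrow> ennreal"
    \<comment> \<open>The flow condition makes the measure invariant under \<open>\<pi>\<close>: the
      fibre over \<open>x\<close> has mass \<open>m x\<close>.\<close>
    have "(\<integral>\<^sup>+x. h (\<pi> x) \<partial>M) = (\<integral>\<^sup>+x. (\<Sum>y | \<pi> y = x. ennreal (m y) * h (\<pi> y)) \<partial>count_space UNIV)"
      unfolding nn_integral_M nn_integral_count_space_fibres[OF finite] ..
    also have "\<dots> = (\<integral>\<^sup>+x. h x \<partial>M)"
      unfolding nn_integral_M
    proof (rule nn_integral_cong)
      fix x
      have "(\<Sum>y | \<pi> y = x. ennreal (m y) * h (\<pi> y)) = (\<Sum>y | \<pi> y = x. ennreal (m y)) * h x"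
        by (simp add: sum_distrib_right)
      also have "(\<Sum>y | \<pi> y = x. ennreal (m y)) = ennreal (m x)"
        using flow_pos m_sum by (simp add: less_imp_le)
      finally show "(\<Sum>y | \<pi> y = x. ennreal (m y) * h (\<pi> y)) = ennreal (m x) * h x" .
    qed
    finally show "(\<integral>\<^sup>+x. (\<Sum>y\<in>{\<pi> x}. ennreal ((\<lambda>_ _. 1) x y) * h y) \<partial>M) \<le> (\<integral>\<^sup>+x. h x \<partial>M)"
      by simp
  qed auto
  then have S: "solid_contraction (Lp_space M p) (Lp_norm M p) point_const (\<lambda>f x. f (\<pi> x))"
    by simp
  have T: "solid_contraction (Lp_space M p) (Lp_norm M p) point_const T"
    unfolding T_def
  proof (rule average_contraction_Lp[OF finite _ weights])
    show "0 \<le> m y / m x" for x y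
      using flow_pos by (simp add: less_imp_le)
    fix h :: "'a \<Rightarrow> ennreal"
    \<comment> \<open>The density \<open>m x\<close> cancels the denominator of the weight, so
      \<open>T\<close> preserves integrals.\<close>
    have "ennreal (m x) * (ennreal (m y / m x) * h y) = ennreal (m y) * h y" for x y
    proof -
      have "ennreal (m x) * ennreal (m y / m x) = ennreal (m y)"
        using flow_pos[of x] flow_pos[of y] by (subst ennreal_mult[symmetric]) auto
      then show ?thesis
        by (simp add: mult.assoc[symmetric])
    qed
    then have "(\<integral>\<^sup>+x. (\<Sum>y | \<pi> y = x. ennreal (m y / m x) * h y) \<partial>M) =
        (\<integral>\<^sup>+x. (\<Sum>y | \<pi> y = x. ennreal (m y) * h y) \<partial>count_space UNIV)"
      unfolding nn_integral_M by (simp add: sum_distrib_left)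
    also have "\<dots> = (\<integral>\<^sup>+x. h x \<partial>M)"
      unfolding nn_integral_M by (rule nn_integral_count_space_fibres[OF finite])
    finally show "(\<integral>\<^sup>+x. (\<Sum>y | \<pi> y = x. ennreal (m y / m x) * h y) \<partial>M) \<le> (\<integral>\<^sup>+x. h x \<partial>M)"
      by simp
  qed
  have "aperiodic_shift (Lp_space M p) (Lp_norm M p) point_const \<pi> T"
  proof (intro aperiodic_shift.intro aperiodic_shift_axioms.intro S T)
    fix f :: "'a \<Rightarrow> complex"
    have "T (\<lambda>x. f (\<pi> x)) x = f x" for x
    proof -
      have "T (\<lambda>x. f (\<pi> x)) x = of_real (\<Sum>y | \<pi> y = x. m y / m x) * f x"
        unfolding T_def by (simp add: sum_distrib_right)
      then show ?thesis
        unfolding weights by simp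
    qed
    then show "T (\<lambda>x. f (\<pi> x)) = f"
      by blast
  qed (rule \<pi>(3))
  then interpret aperiodic_shift "Lp_space M p" "Lp_norm M p" point_const \<pi> T .
  have "flow_laplacian adj \<omega> m = laplacian"
    unfolding flow_laplacian_def laplacian_def T_def \<pi>(2) \<pi>_def[symmetric] fun_eq_iff
    by (simp add: sum_distrib_left sum_divide_distrib mult_ac)
  then show ?thesis
    using spectrum_laplacian by simp
qed

end
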